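(* Let $p$ be a prime, let $n\geq 3$ be an integer and let $G$ be a group of order $p^n$. (i) Assume that $p=2$ and $n=3$. If $d^*(G)>\frac{4}{5}=d^*(D_8)=d'(D_8)$, then $G$ is a Dedekind group. (ii) Assume that $n\geq 4$ if $p=2$, and $n\geq 3$ if $p$ is odd. If $d^*(G)>\frac{(n-2)(p+1)+4}{(n-1)(p+1)+2}=d^*(M_{p^n})=d'(M_{p^n})$, then $G$ is a Dedekind group. The displayed equalities for $D_8$ and $M_{p^n}$ are part of the assertion.
   Context: All groups are finite. For a finite group $G$, $L(G)$ denotes the set (lattice) of all subgroups of $G$, $k'(G)$ the number of conjugacy classes of subgroups of $G$, and $d'(G)=\frac{k'(G)}{|L(G)|}$. A section of $G$ is a quotient $H/K$ with $K\trianglelefteq H\leq G$, and $d^*(G)=\min\{d'(S)\mid S \text{ is a section of } G\}$. A Dedekind group is a group all of whose subgroups are normal. $D_8$ is the dihedral group of order 8. For a prime $p$ and an integer $n$ with $n\geq 4$ if $p=2$ and $n\geq 3$ if $p$ is odd, $M_{p^n}=\langle x,y\mid x^{p^{n-1}}=y^p=1,\ yx=x^{p^{n-2}+1}y\rangle$, a group of order $p^n$. *)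

theory Defs
  imports Complex_Main "HOL-Computational_Algebra.Primes" "HOL-Algebra.Group_Action"
begin

definition subgroups :: "('a, 'b) monoid_scheme \<Rightarrow> 'a set set" where
  "subgroups G = {H. subgroup H G}"

definition subgroup_classes :: "('a, 'b) monoid_scheme \<Rightarrow> 'a set set set" where
  "subgroup_classes G =
     orbits G (subgroups G) (\<lambda>g H. g <#\<^bsub>G\<^esub> H #>\<^bsub>G\<^esub> inv\<^bsub>G\<^esub> g)"

definition d_prime :: "('a, 'b) monoid_scheme \<Rightarrow> real" where
  "d_prime G = real (card (subgroup_classes G)) / real (card (subgroups G))"

text \<open>The sections \<open>H/K\<close> of a finite group form a finite nonempty family, so \<open>Min\<close> is a genuine
  minimum there; it is unspecified for groups whose sections give infinitely many values.\<close>

definition d_star :: "('a, 'b) monoid_scheme \<Rightarrow> real" where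
  "d_star G =
     Min {d_prime (G\<lparr>carrier := H\<rparr> Mod K) | H K. subgroup H G \<and> K \<lhd> G\<lparr>carrier := H\<rparr>}"

definition dedekind_group :: "('a, 'b) monoid_scheme \<Rightarrow> bool" where
  "dedekind_group G \<longleftrightarrow> group G \<and> (\<forall>H. subgroup H G \<longrightarrow> H \<lhd> G)"

text \<open>Group presentations. A word is a list of letters \<open>(x, e)\<close>, standing for the generator \<open>x\<close> if
  \<open>e\<close> is true and for its inverse otherwise. A relation \<open>u = v\<close> is the pair \<open>(u, v)\<close>. All elements
  of the type \<open>'g\<close> are generators. The presented group consists of the classes of words under the
  least congruence that contains the relations and cancels adjacent inverse letters.\<close>

type_synonym 'g word = "('g \<times> bool) list"

inductive_set pres_cong :: "('g word \<times> 'g word) set \<Rightarrow> ('g word \<times> 'g word) set"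
  for R :: "('g word \<times> 'g word) set" where
  rel: "(u, v) \<in> R \<Longrightarrow> (u, v) \<in> pres_cong R"
| cancel: "([(x, e), (x, \<not> e)], []) \<in> pres_cong R"
| refl: "(u, u) \<in> pres_cong R"
| sym: "(u, v) \<in> pres_cong R \<Longrightarrow> (v, u) \<in> pres_cong R"
| trans: "(u, v) \<in> pres_cong R \<Longrightarrow> (v, w) \<in> pres_cong R \<Longrightarrow> (u, w) \<in> pres_cong R"
| append: "(u, u') \<in> pres_cong R \<Longrightarrow> (v, v') \<in> pres_cong R \<Longrightarrow> (u @ v, u' @ v') \<in> pres_cong R"

definition presented_group :: "('g word \<times> 'g word) set \<Rightarrow> 'g word set monoid" where
  "presented_group R =
     \<lparr>carrier = UNIV // pres_cong R,
      monoid.mult = (\<lambda>A B. \<Union>u\<in>A. \<Union>v\<in>B. pres_cong R `` {u @ v}),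
      one = pres_cong R `` {[]}\<rparr>"

lemma equiv_pres_cong: "equiv UNIV (pres_cong R)"
  by (intro equivI refl_onI symI transI) (auto intro: pres_cong.intros)

lemma pres_cong_class_eq:
  "pres_cong R `` {u} = pres_cong R `` {v} \<longleftrightarrow> (u, v) \<in> pres_cong R"
  using eq_equiv_class_iff[OF equiv_pres_cong, of u v R] by simp

lemma presented_group_mult:
  "pres_cong R `` {u} \<otimes>\<^bsub>presented_group R\<^esub> pres_cong R `` {v} = pres_cong R `` {u @ v}"
proof -
  have "(\<Union>u'\<in>pres_cong R `` {u}. \<Union>v'\<in>pres_cong R `` {v}. pres_cong R `` {u' @ v'})
          = (\<Union>u'\<in>pres_cong R `` {u}. \<Union>v'\<in>pres_cong R `` {v}. pres_cong R `` {u @ v})"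
    by (intro SUP_cong HOL.refl)
       (auto simp: pres_cong_class_eq intro: pres_cong.append pres_cong.sym)
  also have "\<dots> = pres_cong R `` {u @ v}"
    using pres_cong.refl[of u R] pres_cong.refl[of v R] by blast
  finally show ?thesis
    by (simp add: presented_group_def)
qed

lemma pres_cong_inverse:
  "(rev (map (\<lambda>(x, e). (x, \<not> e)) w) @ w, []) \<in> pres_cong R"
proof (induction w)
  case Nil
  show ?case by (simp add: pres_cong.refl)
next
  case (Cons a w)
  obtain x e where a: "a = (x, e)" by (cases a)
  let ?w' = "rev (map (\<lambda>(x, e). (x, \<not> e)) w)"
  have "([(x, \<not> e), (x, e)], []) \<in> pres_cong R"
    using pres_cong.cancel[of x "\<not> e" R] by simp
  then have "(?w' @ [(x, \<not> e), (x, e)] @ w, ?w' @ [] @ w) \<in> pres_cong R"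
    by (intro pres_cong.append pres_cong.refl)
  then show ?case
    using Cons.IH a by (auto intro: pres_cong.trans)
qed

lemma presented_group_carrier:
  "carrier (presented_group R) = range (\<lambda>u. pres_cong R `` {u})"
  by (auto simp: presented_group_def quotient_def)

lemma presented_group_one: "\<one>\<^bsub>presented_group R\<^esub> = pres_cong R `` {[]}"
  by (simp add: presented_group_def)

lemma presented_group_is_group: "group (presented_group R)"
proof (rule groupI)
  show "\<exists>y\<in>carrier (presented_group R). y \<otimes>\<^bsub>presented_group R\<^esub> x = \<one>\<^bsub>presented_group R\<^esub>"
    if "x \<in> carrier (presented_group R)" for x
  proof -
    from that obtain w where "x = pres_cong R `` {w}"
      by (auto simp: presented_group_carrier)
    then show ?thesis
      using pres_cong_inverse[of w R]
      by (auto simp: presented_group_carrier presented_group_one presented_group_mult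
          pres_cong_class_eq)
  qed
qed (auto simp: presented_group_carrier presented_group_one presented_group_mult)

datatype xy = Gen_x | Gen_y

abbreviation x_gen :: "xy word" where "x_gen \<equiv> [(Gen_x, True)]"
abbreviation x_inv :: "xy word" where "x_inv \<equiv> [(Gen_x, False)]"
abbreviation y_gen :: "xy word" where "y_gen \<equiv> [(Gen_y, True)]"

definition word_pow :: "'g word \<Rightarrow> nat \<Rightarrow> 'g word" where
  "word_pow w k = concat (replicate k w)"

definition D8 :: "xy word set monoid" where
  "D8 = presented_group
     {(word_pow x_gen 4, []), (word_pow y_gen 2, []), (y_gen @ x_gen, x_inv @ y_gen)}"

definition M_group :: "nat \<Rightarrow> nat \<Rightarrow> xy word set monoid" where
  "M_group p n = presented_group
     {(word_pow x_gen (p ^ (n - 1)), []), (word_pow y_gen p, []),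
      (y_gen @ x_gen, word_pow x_gen (p ^ (n - 2) + 1) @ y_gen)}"

end

theory Submission
  imports Defs "HOL-Algebra.Multiplicative_Group" "HOL-Algebra.Zassenhaus"
begin

text \<open>If \<open>G\<close> is not Dedekind, pick a non-Dedekind section \<open>S\<close> of least order \<open>p^m\<close>. A non-normal
  subgroup of \<open>S\<close> contains no nontrivial normal subgroup, so it contains a non-normal \<open>\<langle>k\<rangle>\<close> of order
  \<open>p\<close>. If \<open>g\<close> does not normalise \<open>\<langle>k\<rangle>\<close>, then \<open>S = \<langle>g, k\<rangle>\<close> because proper subgroups are Dedekind, and
  \<open>z = [g, k]\<close> is central of order \<open>p\<close> and lies in every nontrivial normal subgroup. Hence
  \<open>S/\<langle>z\<rangle>\<close> is a product of cyclic groups of orders \<open>p^(m - 2)\<close> and \<open>p\<close>, and \<open>S\<close> has exactly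
  \<open>N = (m - 2)(p + 1) + 3\<close> normal subgroups. With \<open>c\<close> classes of non-normal subgroups, each of size
  at least \<open>p\<close>, this gives \<open>d'(S) \<le> (N + c)/(N + p c) \<le> (N + 1)/(N + p)\<close>, increasing in \<open>m\<close>.
  For order 8 one has \<open>c \<ge> 2\<close>. The groups \<open>M\<close> and \<open>D\<^sub>8\<close> (which is \<open>M\<close> for \<open>p = 2\<close>, \<open>n = 3\<close>) are
  themselves minimal non-Dedekind, and their non-normal subgroups are the \<open>\<langle>x^i y\<rangle>\<close> of order \<open>p\<close>.\<close>

subsection \<open>Subgroups of an abelian group of type \<open>(p^r, p)\<close>\<close>

text \<open>Why \<open>[g, k]\<close> is central: for any central \<open>Z\<close> of order
  \<open>p\<close> the product \<open>Z <k>\<close> is normal, so the conjugates of the coset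
  \<open>Z k\<close> lie among fewer than \<open>p\<close> cosets \<open>Z k^i\<close>. An orbit
  under a \<open>p\<close>-group has \<open>p\<close>-power length, so \<open>Z k\<close> is fixed
  and \<open>[g, k]\<close> lies in \<open>Z\<close>. The least section may have smaller order than
  \<open>G\<close>, which is why the bound must be monotone in \<open>m\<close>. For the modular
  group itself minimality works the other way: all proper sections have \<open>d' = 1\<close>, so
  \<open>d^*\<close> is attained at the group. Equality there requires classes of size exactly
  \<open>p\<close>. Only the number of \<open>x^i y\<close> of order \<open>p\<close> separates
  \<open>D\<^sub>8\<close> from the other cases. The exponent of \<open>(x^i y)^p\<close> carries a
  correction with factor \<open>p (p - 1) / 2\<close>, which vanishes for odd \<open>p\<close>, is
  harmless for \<open>p = 2\<close>, \<open>n \<ge> 4\<close>, and doubles the count for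
  \<open>n = 3\<close>. Relations only bound a presented group from above; an explicit action is
  what rules out collapse.\<close>

lemma card_subgroups_rank_two:
  fixes e :: "int \<Rightarrow> int \<Rightarrow> 'a"
  assumes "group Q" and p: "prime p"
    and car: "carrier Q = {e a b | a b. True}"
    and mult: "\<And>a b c d. e a b \<otimes>\<^bsub>Q\<^esub> e c d = e (a + c) (b + d)"
    and eq: "\<And>a b c d. e a b = e c d \<longleftrightarrow> int p ^ r dvd a - c \<and> int p dvd b - d"
  shows "card (subgroups Q) = r * (p + 1) + 2"
proof -
  interpret Q: group Q by fact
  \<comment> \<open>The parametrisation runs over all pairs of integers, so that the group operation
    is plain addition. By \<open>eq\<close> only residues modulo \<open>p^r\<close> and
    \<open>p\<close> count: \<open>Q\<close> is a product of cyclic groups of these orders.\<close>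
  define P where "P = int p"
  have P: "prime P" "P > 1" using p prime_gt_1_nat[OF p] by (auto simp: P_def)
  note eq = eq[folded P_def]
  have in_car [simp]: "e a b \<in> carrier Q" for a b using car by auto
  have one: "\<one>\<^bsub>Q\<^esub> = e 0 0"
    using mult[of 0 0 0 0] by (simp add: Q.l_cancel_one)
  have inv: "inv\<^bsub>Q\<^esub> (e a b) = e (-a) (-b)" for a b
    by (rule Q.inv_equality) (auto simp: mult one)
  have npow: "e a b [^]\<^bsub>Q\<^esub> (n::nat) = e (int n * a) (int n * b)" for a b n
    by (induction n) (auto simp: one mult algebra_simps)
  have pow: "e a b [^]\<^bsub>Q\<^esub> (n::int) = e (n * a) (n * b)" for a b n
    by (cases n rule: int_cases2) (auto simp: int_pow_int Q.int_pow_neg npow inv)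
  \<comment> \<open>Subgroups containing the second factor are the \<open>B i\<close>; the others are cyclic: \<open>C i j\<close> with
    \<open>i < r\<close>, \<open>j < p\<close>, and the trivial group \<open>C r 0\<close>.\<close>
  define B where "B i = {e (P ^ i * a) b | a b. True}" for i
  define C where "C i j = {e (P ^ i * a) (int j * a) | a. True}" for i j
  have B_mem: "e c d \<in> B i \<longleftrightarrow> P ^ i dvd c" if "i \<le> r" for c d i
  proof
    assume "e c d \<in> B i"
    then obtain a b where "e c d = e (P ^ i * a) b" by (auto simp: B_def)
    then have "P ^ r dvd c - P ^ i * a" by (simp add: eq)
    then have "P ^ i dvd c - P ^ i * a" using that by (meson dvd_trans le_imp_power_dvd)
    then show "P ^ i dvd c" by (simp add: dvd_diff_left_iff)
  qed (auto simp: B_def elim!: dvdE)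
  have C_mem: "e c d \<in> C i j \<longleftrightarrow> (\<exists>a. P ^ r dvd c - P ^ i * a \<and> P dvd d - int j * a)" for c d i j
    by (auto simp: C_def eq)
  have sub_B: "subgroup (B i) Q" for i
  proof (rule Q.subgroupI)
    show "B i \<subseteq> carrier Q" "B i \<noteq> {}" by (auto simp: B_def)
    show "inv\<^bsub>Q\<^esub> x \<in> B i" if "x \<in> B i" for x
    proof -
      from that obtain a b where "x = e (P ^ i * a) b" by (auto simp: B_def)
      then have "inv\<^bsub>Q\<^esub> x = e (P ^ i * (-a)) (-b)" by (simp add: inv)
      then show ?thesis unfolding B_def by blast
    qed
    show "x \<otimes>\<^bsub>Q\<^esub> y \<in> B i" if "x \<in> B i" "y \<in> B i" for x y
    proof -
      from that obtain a b c d where "x = e (P ^ i * a) b" "y = e (P ^ i * c) d" by (auto simp: B_def)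
      then have "x \<otimes>\<^bsub>Q\<^esub> y = e (P ^ i * (a + c)) (b + d)" by (simp add: mult algebra_simps)
      then show ?thesis unfolding B_def by blast
    qed
  qed
  have sub_C: "subgroup (C i j) Q" for i j
  proof (rule Q.subgroupI)
    show "C i j \<subseteq> carrier Q" "C i j \<noteq> {}" by (auto simp: C_def)
    show "inv\<^bsub>Q\<^esub> x \<in> C i j" if "x \<in> C i j" for x
    proof -
      from that obtain a where "x = e (P ^ i * a) (int j * a)" by (auto simp: C_def)
      then have "inv\<^bsub>Q\<^esub> x = e (P ^ i * (-a)) (int j * (-a))" by (simp add: inv)
      then show ?thesis unfolding C_def by blast
    qed
    show "x \<otimes>\<^bsub>Q\<^esub> y \<in> C i j" if "x \<in> C i j" "y \<in> C i j" for x y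
    proof -
      from that obtain a b where "x = e (P ^ i * a) (int j * a)" "y = e (P ^ i * b) (int j * b)"
        by (auto simp: C_def)
      then have "x \<otimes>\<^bsub>Q\<^esub> y = e (P ^ i * (a + b)) (int j * (a + b))" by (simp add: mult algebra_simps)
      then show ?thesis unfolding C_def by blast
    qed
  qed
  let ?I = "{0..<r} \<times> {0..<p}"
  have cover: "A \<in> B ` {0..r} \<union> (\<lambda>(i, j). C i j) ` ?I \<union> {C r 0}" if A: "subgroup A Q" for A
  proof -
    have A_mult: "e (a + c) (b + d) \<in> A" if "e a b \<in> A" "e c d \<in> A" for a b c d
      using subgroup.m_closed[OF A that] by (simp add: mult)
    have A_pow: "e (n * a) (n * b) \<in> A" if "e a b \<in> A" for n a b
      using Q.subgroup_int_pow_closed[OF A that, of n] by (simp add: pow)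
    have A_car: "\<exists>a b. x = e a b" if "x \<in> A" for x
      using subgroup.mem_carrier[OF A that] car by auto
    have A_eq: "e c d \<in> A" if "e a b \<in> A" "P ^ r dvd a - c" "P dvd b - d" for a b c d
      using that eq[of a b c d] by simp
    have "e (P ^ r) 0 \<in> A"
      using subgroup.one_closed[OF A] A_eq[of 0 0 "P ^ r" 0] by (simp add: one)
    then have ex_r: "\<exists>b. e (P ^ r) b \<in> A" by blast
    \<comment> \<open>\<open>P^i\<close> generates the projection of \<open>A\<close> to the first
      coordinate; \<open>i\<close> is at most \<open>r\<close> because \<open>P^r\<close> represents
      zero there.\<close>
    define i where "i = (LEAST i. \<exists>b. e (P ^ i) b \<in> A)"
    have i: "\<exists>b. e (P ^ i) b \<in> A" unfolding i_def by (rule LeastI, rule ex_r)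
    have i_le: "i \<le> r" unfolding i_def by (rule Least_le, rule ex_r)
    have i_dvd: "P ^ i dvd a" if ab: "e a b \<in> A" for a b
    proof -
      \<comment> \<open>The gcd is a power of \<open>P\<close>, and Bezout puts it into the
        projection, so the minimality of \<open>i\<close> applies to it.\<close>
      have "gcd a (P ^ r) dvd P ^ r" by simp
      then obtain k where k: "k \<le> r" "gcd a (P ^ r) = P ^ k"
        using divides_primepow[OF P(1), of "gcd a (P ^ r)" r] by auto
      obtain u v where "u * a + v * P ^ r = P ^ k"
        using bezout_int[of a "P ^ r"] k by auto
      then have "P ^ r dvd u * a - P ^ k" by (metis add_diff_cancel_left' diff_diff_eq2 dvd_def dvd_minus_iff minus_diff_eq mult.commute)
      then have "e (P ^ k) (u * b) \<in> A" using A_eq[OF A_pow[OF ab, of u]] by simp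
      then have "i \<le> k" unfolding i_def by (intro Least_le) blast
      then have "P ^ i dvd P ^ k" by (rule le_imp_power_dvd)
      also have "P ^ k dvd a" using k(2) by (metis gcd_dvd1)
      finally show ?thesis .
    qed
    show ?thesis
    proof (cases "e 0 1 \<in> A")
      case True
      have "A = B i"
      proof
        show "A \<subseteq> B i" using A_car i_dvd B_mem[OF i_le] by blast
        show "B i \<subseteq> A"
        proof
          fix x assume "x \<in> B i"
          then obtain a b where x: "x = e (P ^ i * a) b" by (auto simp: B_def)
          obtain d where "e (P ^ i) d \<in> A" using i by blast
          from A_mult[OF A_pow[OF this, of a] A_pow[OF True, of "b - a * d"]]
          show "x \<in> A" by (simp add: x algebra_simps)
        qed
      qed
      then show ?thesis using i_le by auto
    next
      case False
      \<comment> \<open>The second factor has prime order, so \<open>A\<close> meets it trivially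
        once \<open>e 0 1\<close> is missing. An element of \<open>A\<close> is then determined by
        its first coordinate, and \<open>A\<close> is cyclic.\<close>
      have P_dvd: "P dvd b" if "e 0 b \<in> A" for b
      proof (rule ccontr)
        assume "\<not> P dvd b"
        then have "coprime b P" using P(1) by (metis coprime_commute prime_imp_coprime)
        then obtain u v where "u * b + v * P = 1"
          using bezout_int[of b P] by (metis coprime_imp_gcd_eq_1)
        then have "P dvd u * b - 1" by (metis add_diff_cancel_left' diff_diff_eq2 dvd_def dvd_minus_iff minus_diff_eq mult.commute)
        then have "e 0 1 \<in> A" using A_eq[OF A_pow[OF that, of u], of 0 1] by simp
        then show False using False by contradiction
      qed
      have A_is: "A = C i j" if cj: "e (P ^ i) (int j) \<in> A" for j
      proof
        show "C i j \<subseteq> A" using A_pow[OF cj] by (auto simp: C_def mult.commute)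
        show "A \<subseteq> C i j"
        proof
          fix x assume x: "x \<in> A"
          then obtain a b where ab: "x = e a b" using A_car by blast
          then obtain c where c: "a = P ^ i * c" using i_dvd[of a b] x ab by (auto simp: dvd_def)
          from A_mult[OF x[unfolded ab] A_pow[OF cj, of "-c"]]
          have "e 0 (b - int j * c) \<in> A" by (simp add: c algebra_simps)
          then show "x \<in> C i j" unfolding ab C_mem c by (intro exI[of _ c]) (use P_dvd in auto)
        qed
      qed
      obtain d where d: "e (P ^ i) d \<in> A" using i by blast
      define j where "j = nat (d mod P)"
      have j: "j < p" "int j = d mod P" using P(2) by (auto simp: j_def P_def nat_less_iff)
      have j_A: "e (P ^ i) (int j) \<in> A" using A_eq[OF d, of "P ^ i" "int j"] j by simp
      show ?thesis
      proof (cases "i = r")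
        case True
        \<comment> \<open>For \<open>i = r\<close> the first coordinate is zero throughout, so
          \<open>A\<close> is trivial. Only \<open>j = 0\<close> fits: \<open>C r j\<close> with
          \<open>0 < j < p\<close> would be the second factor, which is \<open>B r\<close>.\<close>
        have "A = C i 0"
          by (rule A_is) (use True \<open>e (P ^ r) 0 \<in> A\<close> in auto)
        then show ?thesis using True by simp
      next
        case False
        then have "(i, j) \<in> ?I" using i_le j by auto
        moreover have "A = C i j" using A_is[OF j_A] .
        ultimately show ?thesis by blast
      qed
    qed
  qed
  have C_C: "i' \<le> i" if "e (P ^ i) (int j) \<in> C i' j'" "i' \<le> r" for i j i' j'
  proof -
    from that obtain a where "P ^ r dvd P ^ i - P ^ i' * a" by (auto simp: C_mem)
    then have "P ^ i' dvd P ^ i - P ^ i' * a" using that(2) by (meson dvd_trans le_imp_power_dvd)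
    then have "P ^ i' dvd P ^ i" by (simp add: dvd_diff_left_iff)
    then have "P ^ i' \<le> P ^ i" using P(2) by (intro zdvd_imp_le) auto
    then show ?thesis using P(2) by simp
  qed
  have C_self: "e (P ^ i) (int j) \<in> C i j" for i j
    unfolding C_mem by (rule exI[of _ 1]) simp
  \<comment> \<open>The index \<open>i\<close> is visible in the first coordinates. For
    \<open>i < r\<close>, cancelling \<open>P^i\<close> forces the multiplier \<open>a\<close> to be
    1 modulo \<open>P\<close>, which pins down \<open>j\<close>.\<close>
  have C_inj: "i = i' \<and> (i < r \<longrightarrow> j = j')"
    if "C i j = C i' j'" "i \<le> r" "i' \<le> r" "j < p" "j' < p" for i j i' j'
  proof -
    have ii: "i = i'" using C_C[of i j i' j'] C_C[of i' j' i j] C_self[of i j] C_self[of i' j'] that by auto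
    have "j = j'" if "i < r"
    proof -
      have "e (P ^ i) (int j) \<in> C i j'" using C_self[of i j] \<open>C i j = C i' j'\<close> ii by simp
      then obtain a where a: "P ^ r dvd P ^ i - P ^ i * a" "P dvd int j - int j' * a" by (auto simp: C_mem)
      have "P ^ Suc i dvd P ^ r" using \<open>i < r\<close> by (intro le_imp_power_dvd) simp
      then have "P ^ Suc i dvd P ^ i - P ^ i * a" using a(1) by (rule dvd_trans)
      moreover have "P ^ i - P ^ i * a = P ^ i * (1 - a)" by (simp add: algebra_simps)
      ultimately have "P ^ i * P dvd P ^ i * (1 - a)" by (simp add: mult.commute)
      then have "P dvd 1 - a" using P(2) by simp
      then have "P dvd int j' * (1 - a)" by simp
      then have "P dvd int j - int j' * a - int j' * (1 - a)" using a(2) by (rule dvd_diff[rotated])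
      then have "P dvd int j - int j'" by (simp add: algebra_simps)
      then show "j = j'" using \<open>j < p\<close> \<open>j' < p\<close>
        by (metis P_def mod_eq_dvd_iff mod_less of_nat_eq_iff of_nat_mod)
    qed
    with ii show ?thesis by simp
  qed
  \<comment> \<open>Membership of \<open>e 0 1\<close> separates the two families.\<close>
  have "e 0 1 \<in> B i" if "i \<le> r" for i using B_mem[OF that] by simp
  moreover have "e 0 1 \<notin> C i j" if "i < r \<or> (i = r \<and> j = 0)" for i j
  proof
    assume "e 0 1 \<in> C i j"
    then obtain a where a: "P ^ r dvd P ^ i * a" "P dvd 1 - int j * a" by (auto simp: C_mem)
    have "P dvd int j * a"
    proof (cases "j = 0")
      case False
      then have "P ^ i * P dvd P ^ r" using that by (metis Suc_leI le_imp_power_dvd power_Suc2)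
      then have "P ^ i * P dvd P ^ i * a" using a(1) by (rule dvd_trans)
      then show ?thesis using P(2) by simp
    qed simp
    then have "P dvd (1 - int j * a) + int j * a" using a(2) by (rule dvd_add[rotated])
    then have "P dvd 1" by simp
    then show False using P by simp
  qed
  ultimately have BC: "B i \<noteq> C i' j'" if "i \<le> r" "i' < r \<or> i' = r \<and> j' = 0" for i i' j'
    using that by metis
  have "inj_on B {0..r}"
  proof (rule inj_onI)
    fix i i' assume a: "i \<in> {0..r}" "i' \<in> {0..r}" "B i = B i'"
    have "P ^ i dvd P ^ i'" "P ^ i' dvd P ^ i"
      using a B_mem[of i "P ^ i'" 0] B_mem[of i' "P ^ i'" 0] B_mem[of i' "P ^ i" 0] B_mem[of i "P ^ i" 0] by auto
    then have "P ^ i \<le> P ^ i'" "P ^ i' \<le> P ^ i" using P(2) by (simp_all only: zdvd_imp_le zero_less_power)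
    then show "i = i'" using P(2) by simp
  qed
  then have cB: "card (B ` {0..r}) = r + 1" by (simp add: card_image)
  have "inj_on (\<lambda>(i, j). C i j) ?I"
    by (rule inj_onI) (use C_inj in fastforce)
  then have cC: "card ((\<lambda>(i, j). C i j) ` ?I) = r * p" by (simp add: card_image)
  have "subgroups Q = B ` {0..r} \<union> (\<lambda>(i, j). C i j) ` ?I \<union> {C r 0}"
    using cover sub_B sub_C by (auto simp: subgroups_def)
  moreover have "B ` {0..r} \<inter> (\<lambda>(i, j). C i j) ` ?I = {}" using BC by fastforce
  moreover have "C r 0 \<notin> B ` {0..r} \<union> (\<lambda>(i, j). C i j) ` ?I"
  proof
    assume "C r 0 \<in> B ` {0..r} \<union> (\<lambda>(i, j). C i j) ` ?I"
    then consider i where "i \<le> r" "C r 0 = B i" | i j where "i < r" "j < p" "C r 0 = C i j" by auto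
    then show False
    proof cases
      case 1 then show False using BC[of i r 0] by simp
    next
      case 2 then show False using C_inj[of r 0 i j] by simp
    qed
  qed
  ultimately show ?thesis using cB cC
    by (simp add: card_Un_disjoint card_insert_if)
qed

subsection \<open>Conjugacy classes of subgroups\<close>

abbreviation conj_class :: "('a, 'b) monoid_scheme \<Rightarrow> 'a set \<Rightarrow> 'a set set" where
  "conj_class G \<equiv> orbit G (\<lambda>g H. g <#\<^bsub>G\<^esub> H #>\<^bsub>G\<^esub> inv\<^bsub>G\<^esub> g)"

definition nonnormal_subgroups :: "('a, 'b) monoid_scheme \<Rightarrow> 'a set set" where
  "nonnormal_subgroups G = {H. subgroup H G \<and> \<not> H \<lhd> G}"

text \<open>The conjugation action in the library is restricted to the set of subgroups, whereas
  \<open>subgroup_classes\<close> uses the bare map on sets. This equation makes the orbit lemmas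
  available for \<open>conj_class\<close>.\<close>

lemma (in group) conj_class_eq:
  assumes "subgroup H G"
  shows "conj_class G H = orbit G (\<lambda>g. \<lambda>H\<in>{H. subgroup H G}. g <# H #> inv g) H"
  using assms by (simp add: orbit_def)

lemma (in group) mem_conj:
  assumes "H \<subseteq> carrier G" "g \<in> carrier G"
  shows "x \<in> g <# H #> inv g \<longleftrightarrow> (\<exists>h\<in>H. x = g \<otimes> h \<otimes> inv g)"
  by (auto simp: l_coset_def r_coset_def)

lemma (in group) normal_conj_class:
  assumes "H \<lhd> G"
  shows "conj_class G H = {H}"
proof -
  have H: "subgroup H G" using assms by (rule normal_imp_subgroup)
  have "g <# H #> inv g = H" if "g \<in> carrier G" for g
    using assms that subgroup.subset[OF H]
    by (metis coset_mult_assoc coset_mult_one inv_closed normal.coset_eq r_inv)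
  then show ?thesis by (auto simp: orbit_def)
qed

lemma (in group) nonnormal_conj_class:
  assumes "subgroup H G" "\<not> H \<lhd> G"
  shows "\<exists>H'\<in>conj_class G H. H' \<noteq> H"
proof -
  obtain g h where g: "g \<in> carrier G" "h \<in> H" "g \<otimes> h \<otimes> inv g \<notin> H"
    using assms normal_inv_iff by blast
  then have "g <# H #> inv g \<noteq> H"
    using mem_conj[OF subgroup.subset[OF assms(1)] g(1)] by blast
  then show ?thesis using g(1) by (auto simp: orbit_def)
qed

lemma (in group) subgroup_classes_eq: "subgroup_classes G = conj_class G ` subgroups G"
  by (auto simp: subgroup_classes_def orbits_def)

lemma (in group) finite_subgroups:
  assumes "finite (carrier G)"
  shows "finite (subgroups G)"
  by (rule finite_subset[of _ "Pow (carrier G)"]) (auto simp: subgroups_def assms dest: subgroup.subset)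

lemma (in group) card_subgroups_pos:
  assumes "finite (carrier G)"
  shows "card (subgroups G) > 0"
  using finite_subgroups[OF assms] subgroup_self by (auto simp: card_gt_0_iff subgroups_def)

lemma (in group) d_prime_le_1:
  assumes "finite (carrier G)"
  shows "d_prime G \<le> 1"
  using card_image_le[OF finite_subgroups[OF assms], of "conj_class G"] card_subgroups_pos[OF assms]
  by (simp add: d_prime_def subgroup_classes_eq)

lemma (in group) d_prime_dedekind:
  assumes "finite (carrier G)" "dedekind_group G"
  shows "d_prime G = 1"
proof -
  have "conj_class G ` subgroups G = (\<lambda>H. {H}) ` subgroups G"
    using assms(2) by (intro image_cong) (auto simp: dedekind_group_def subgroups_def normal_conj_class)
  then have "card (subgroup_classes G) = card (subgroups G)"
    by (simp add: subgroup_classes_eq card_image)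
  then show ?thesis using card_subgroups_pos[OF assms(1)] by (simp add: d_prime_def)
qed

text \<open>A normal conjugate \<open>A\<close> of \<open>H\<close> would have the class
  \<open>{A}\<close>, which contains \<open>H\<close> because orbits are symmetric.\<close>

lemma (in group) conj_class_subset:
  assumes "H \<in> nonnormal_subgroups G"
  shows "conj_class G H \<subseteq> nonnormal_subgroups G"
proof
  interpret act: group_action G "{H. subgroup H G}" "\<lambda>g. \<lambda>H\<in>{H. subgroup H G}. g <# H #> inv g"
    by (rule action_by_conjugation_on_subgroups_set)
  fix A assume A: "A \<in> conj_class G H"
  have H: "subgroup H G" "\<not> H \<lhd> G" using assms by (auto simp: nonnormal_subgroups_def)
  have sA: "subgroup A G"
    using A act.orbits_coverture H by (auto simp: orbits_def conj_class_eq)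
  have "H \<in> conj_class G A"
    using act.orbit_sym[of H A] A H sA by (simp add: conj_class_eq)
  then have "\<not> A \<lhd> G" using normal_conj_class H by auto
  with sA show "A \<in> nonnormal_subgroups G" by (simp add: nonnormal_subgroups_def)
qed

lemma (in group) conj_class_disjoint:
  assumes "subgroup A G" "subgroup B G" "conj_class G A \<noteq> conj_class G B"
  shows "conj_class G A \<inter> conj_class G B = {}"
proof -
  interpret act: group_action G "{H. subgroup H G}" "\<lambda>g. \<lambda>H\<in>{H. subgroup H G}. g <# H #> inv g"
    by (rule action_by_conjugation_on_subgroups_set)
  show ?thesis using act.disjoint_union[of "conj_class G A" "conj_class G B"] assms
    by (auto simp: orbits_def conj_class_eq)
qed

lemma (in group) conj_class_self:
  assumes "subgroup A G"
  shows "A \<in> conj_class G A"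
  using group_action.orbit_refl[OF action_by_conjugation_on_subgroups_set, of A] assms
  by (simp add: conj_class_eq)

lemma (in group) nonnormal_Union:
  "\<Union> (conj_class G ` nonnormal_subgroups G) = nonnormal_subgroups G"
  using conj_class_subset conj_class_self by (fastforce simp: nonnormal_subgroups_def)

text \<open>Normal subgroups form singleton classes, so numerator and denominator of
  \<open>d_prime\<close> share this summand and differ only in the non-normal part.\<close>

lemma (in group) card_normal_nonnormal:
  assumes "finite (carrier G)"
  shows "card (subgroups G) = card {N. N \<lhd> G} + card (nonnormal_subgroups G)"
    and "card (subgroup_classes G) = card {N. N \<lhd> G} + card (conj_class G ` nonnormal_subgroups G)"
proof -
  have split: "subgroups G = {N. N \<lhd> G} \<union> nonnormal_subgroups G"
    by (auto simp: subgroups_def nonnormal_subgroups_def dest: normal_imp_subgroup)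
  then have fin: "finite {N. N \<lhd> G}" "finite (nonnormal_subgroups G)"
    using finite_subgroups[OF assms] by auto
  show "card (subgroups G) = card {N. N \<lhd> G} + card (nonnormal_subgroups G)"
    unfolding split by (rule card_Un_disjoint[OF fin]) (auto simp: nonnormal_subgroups_def)
  have "conj_class G ` {N. N \<lhd> G} = (\<lambda>N. {N}) ` {N. N \<lhd> G}"
    by (intro image_cong) (auto simp: normal_conj_class)
  moreover have "conj_class G ` {N. N \<lhd> G} \<inter> conj_class G ` nonnormal_subgroups G = {}"
  proof -
    have "conj_class G N \<noteq> conj_class G H" if "N \<lhd> G" "H \<in> nonnormal_subgroups G" for N H
      using that normal_conj_class[of N] nonnormal_conj_class[of H] conj_class_self[of H]
      by (auto simp: nonnormal_subgroups_def)
    then show ?thesis by blast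
  qed
  ultimately show "card (subgroup_classes G) = card {N. N \<lhd> G} + card (conj_class G ` nonnormal_subgroups G)"
    using fin by (simp add: subgroup_classes_eq split image_Un card_Un_disjoint card_image)
qed

section \<open>Orbits under groups of prime power order\<close>

lemma prime_dvd_of_dvd_prime_power:
  fixes p d m :: nat
  assumes "prime p" "d dvd p ^ m" "d \<noteq> 1"
  shows "p dvd d"
  using assms divides_primepow_nat[OF assms(1), of d m] by (metis dvd_power gr0I power_0)

lemma (in group_action) card_orbit_prime_power:
  assumes "prime p" "order G = p ^ m" "x \<in> E" "orbit G \<phi> x \<noteq> {x}"
  shows "p dvd card (orbit G \<phi> x)"
proof (rule prime_dvd_of_dvd_prime_power[OF assms(1)])
  show "card (orbit G \<phi> x) dvd p ^ m"
    using orbit_stabilizer_theorem[OF assms(3)] assms(2) by (metis dvd_triv_left)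
  show "card (orbit G \<phi> x) \<noteq> 1"
    using orbit_refl[OF assms(3)] assms(4) by (auto simp: card_1_singleton_iff)
qed

text \<open>A class of non-normal subgroups has more than one member, so its size is a positive
  multiple of \<open>p\<close>; summing over the disjoint classes gives the bound.\<close>

lemma (in group) p_group_nonnormal_classes:
  assumes "prime p" "order G = p ^ m"
  shows "p * card (conj_class G ` nonnormal_subgroups G) \<le> card (nonnormal_subgroups G)"
proof -
  interpret act: group_action G "{H. subgroup H G}" "\<lambda>g. \<lambda>H\<in>{H. subgroup H G}. g <# H #> inv g"
    by (rule action_by_conjugation_on_subgroups_set)
  have fin: "finite (carrier G)"
    using assms by (metis order_gt_0_iff_finite prime_gt_0_nat zero_less_power)
  have finN: "finite (nonnormal_subgroups G)"
    using finite_subgroups[OF fin] by (auto simp: subgroups_def nonnormal_subgroups_def intro: finite_subset[rotated])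
  have size: "p \<le> card (conj_class G H)" if "H \<in> nonnormal_subgroups G" for H
  proof -
    have H: "subgroup H G" "\<not> H \<lhd> G" using that by (auto simp: nonnormal_subgroups_def)
    have "p dvd card (conj_class G H)"
      using act.card_orbit_prime_power[OF assms, of H] nonnormal_conj_class[OF H] H
      by (auto simp: conj_class_eq)
    moreover have "finite (conj_class G H)"
      using conj_class_subset[OF that] finN finite_subset by blast
    then have "card (conj_class G H) > 0"
      using conj_class_self[OF H(1)] by (auto simp: card_gt_0_iff)
    ultimately show ?thesis by (rule dvd_imp_le)
  qed
  have "p * card (conj_class G ` nonnormal_subgroups G) \<le> (\<Sum>K\<in>conj_class G ` nonnormal_subgroups G. card K)"
    using sum_bounded_below[of "conj_class G ` nonnormal_subgroups G" p card] size by (auto simp: mult.commute)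
  also have "\<dots> = card (\<Union> (conj_class G ` nonnormal_subgroups G))"
  proof (rule card_Union_disjoint[symmetric])
    show "pairwise disjnt (conj_class G ` nonnormal_subgroups G)"
      using conj_class_disjoint by (fastforce simp: pairwise_def disjnt_def nonnormal_subgroups_def)
    show "finite A" if "A \<in> conj_class G ` nonnormal_subgroups G" for A
      using that conj_class_subset finN finite_subset by blast
  qed
  finally show ?thesis by (simp add: nonnormal_Union)
qed

text \<open>Class equation: if only \<open>\<one>\<close> were central, every other class of
  elements would have size divisible by \<open>p\<close>, and the order would be 1 modulo
  \<open>p\<close>.\<close>

lemma (in group) p_group_central_element:
  assumes "prime p" "order G = p ^ m" "m > 0"
  shows "\<exists>z\<in>carrier G. z \<noteq> \<one> \<and> (\<forall>g\<in>carrier G. g \<otimes> z = z \<otimes> g)"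
proof (rule ccontr)
  assume no: "\<not> ?thesis"
  let ?c = "\<lambda>g. \<lambda>h\<in>carrier G. g \<otimes> h \<otimes> inv g"
  interpret act: group_action G "carrier G" ?c by (rule action_by_conjugation)
  have fin: "finite (carrier G)"
    using assms by (metis order_gt_0_iff_finite prime_gt_0_nat zero_less_power)
  let ?O = "orbits G (carrier G) ?c"
  have one: "orbit G ?c \<one> = {\<one>}" using act.orbit_refl[of \<one>] by (auto simp: orbit_def)
  then have one_in: "{\<one>} \<in> ?O" unfolding orbits_def by blast
  have "p dvd card orb" if "orb \<in> ?O - {{\<one>}}" for orb
  proof -
    from that obtain x where x: "x \<in> carrier G" "orb = orbit G ?c x" by (auto simp: orbits_def)
    have "x \<noteq> \<one>" using that x one by auto
    then obtain g where g: "g \<in> carrier G" "g \<otimes> x \<noteq> x \<otimes> g" using no x by blast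
    then have "g \<otimes> x \<otimes> inv g \<noteq> x" using x by (metis inv_closed inv_solve_right m_closed)
    moreover have "g \<otimes> x \<otimes> inv g \<in> orbit G ?c x" using g x by (force simp: orbit_def)
    ultimately have "orbit G ?c x \<noteq> {x}" by blast
    then show ?thesis using act.card_orbit_prime_power[OF assms(1,2) x(1)] x by simp
  qed
  then have "p dvd (\<Sum>orb\<in>?O - {{\<one>}}. card orb)" by (rule dvd_sum)
  moreover have "finite ?O" using fin by (simp add: orbits_def)
  then have "(\<Sum>orb\<in>?O. card orb) = 1 + (\<Sum>orb\<in>?O - {{\<one>}}. card orb)"
    using sum.remove[OF _ one_in, of card] by simp
  moreover have "(\<Sum>orb\<in>?O. card orb) = order G"
    using act.disjoint_sum[OF fin, of "\<lambda>_. 1::nat"] by (simp add: order_def)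
  ultimately have "p dvd order G - 1" "order G > 0" by auto
  moreover have "p dvd order G" using assms by simp
  ultimately have "p dvd 1" by (metis One_nat_def Suc_pred dvd_add_right_iff plus_1_eq_Suc add.commute)
  then show False using assms(1) by simp
qed

lemma (in group) p_group_power_of_order_p:
  assumes "prime p" "order G = p ^ m" "x \<in> carrier G" "x \<noteq> \<one>"
  obtains n :: nat where "ord (x [^] n) = p"
proof -
  obtain k where k: "ord x = p ^ k"
    using ord_dvd_group_order[OF assms(3)] divides_primepow_nat[OF assms(1)] assms(2) by metis
  have "k > 0" using k ord_eq_1[OF assms(3)] assms(4) by (cases k) auto
  then have "p ^ k = p ^ (k - 1) * p" by (cases k) auto
  then have "ord (x [^] (p ^ (k - 1))) = p"
    using ord_pow[OF assms(3), of "p ^ (k - 1)"] k assms(1) by (simp add: prime_gt_0_nat)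
  then show ?thesis by (rule that)
qed

subsection \<open>Minimal non-Dedekind sections\<close>

lemma (in normal) Mod_conj:
  assumes "x \<in> carrier G" "y \<in> carrier G"
  shows "(H #> x) \<otimes>\<^bsub>G Mod H\<^esub> (H #> y) \<otimes>\<^bsub>G Mod H\<^esub> inv\<^bsub>G Mod H\<^esub> (H #> x) = H #> (x \<otimes> y \<otimes> inv x)"
proof -
  have "inv\<^bsub>G Mod H\<^esub> (H #> x) = H #> inv x"
    using inv_FactGroup[of "H #> x"] rcos_inv[OF assms(1)] assms(1) by (simp add: carrier_FactGroup)
  then show ?thesis using assms by (simp add: rcos_sum)
qed

lemma (in normal) mem_Union_Mod:
  assumes "subgroup A (G Mod H)" "x \<in> carrier G"
  shows "x \<in> \<Union>A \<longleftrightarrow> H #> x \<in> A"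
  using factgroup_subgroup_union_char[OF assms(1)] assms(2) by blast

lemma (in normal) subset_Union_Mod:
  assumes "subgroup A (G Mod H)"
  shows "H \<subseteq> \<Union>A"
  using subgroup.one_closed[OF assms] by auto

lemma (in normal) Union_rcosets_above:
  assumes "subgroup A G" "H \<subseteq> A"
  shows "\<Union>((\<lambda>x. H #> x) ` A) = A"
proof
  show "\<Union>((\<lambda>x. H #> x) ` A) \<subseteq> A"
    using assms subgroup.m_closed by (fastforce simp: r_coset_def)
  show "A \<subseteq> \<Union>((\<lambda>x. H #> x) ` A)"
    using rcos_self[OF subgroup.mem_carrier[OF assms(1)] is_subgroup] by blast
qed

lemma (in normal) subgroup_rcosets_above:
  assumes "subgroup A G" "H \<subseteq> A"
  shows "subgroup ((\<lambda>x. H #> x) ` A) (G Mod H)"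
proof -
  have "group_hom G (G Mod H) (\<lambda>x. H #> x)"
    unfolding group_hom_def group_hom_axioms_def
    using factorgroup_is_group r_coset_hom_Mod is_group by blast
  then show ?thesis using assms(1) by (rule group_hom.subgroup_img_is_subgroup)
qed

lemma (in normal) rcosets_Union_Mod:
  assumes "subgroup A (G Mod H)"
  shows "(\<lambda>x. H #> x) ` (\<Union>A) = A"
proof
  show "(\<lambda>x. H #> x) ` (\<Union>A) \<subseteq> A"
    using factgroup_subgroup_union_char[OF assms] by auto
  show "A \<subseteq> (\<lambda>x. H #> x) ` (\<Union>A)"
    using subgroup.subset[OF assms] factgroup_subgroup_union_char[OF assms]
    by (auto simp: carrier_FactGroup)
qed

text \<open>Elements of the quotient are cosets, i.e. sets, so the preimage of a subgroup
  \<open>A\<close> of the quotient is simply \<open>\<Union>A\<close>.\<close>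

lemma (in normal) bij_betw_subgroups_Mod:
  "bij_betw Union (subgroups (G Mod H)) {A. subgroup A G \<and> H \<subseteq> A}"
proof (rule bij_betw_byWitness[where f' = "\<lambda>A. (\<lambda>x. H #> x) ` A"])
  show "\<forall>A\<in>subgroups (G Mod H). (\<lambda>x. H #> x) ` (\<Union>A) = A"
    by (auto simp: subgroups_def rcosets_Union_Mod)
  show "\<forall>A\<in>{A. subgroup A G \<and> H \<subseteq> A}. \<Union>((\<lambda>x. H #> x) ` A) = A"
    using Union_rcosets_above by blast
  show "Union ` subgroups (G Mod H) \<subseteq> {A. subgroup A G \<and> H \<subseteq> A}"
    using factgroup_subgroup_union_subgroup subset_Union_Mod by (auto simp: subgroups_def)
  show "(\<lambda>A. (\<lambda>x. H #> x) ` A) ` {A. subgroup A G \<and> H \<subseteq> A} \<subseteq> subgroups (G Mod H)"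
    using subgroup_rcosets_above by (auto simp: subgroups_def)
qed

lemma (in normal) Mod_normal_iff:
  assumes "subgroup A (G Mod H)"
  shows "A \<lhd> G Mod H \<longleftrightarrow> \<Union>A \<lhd> G"
proof
  interpret Q: group "G Mod H" by (rule factorgroup_is_group)
  assume N: "\<Union>A \<lhd> G"
  show "A \<lhd> G Mod H"
  proof (rule Q.normal_invI[OF assms])
    fix X Y assume X: "X \<in> carrier (G Mod H)" and "Y \<in> A"
    have "Y \<in> carrier (G Mod H)" using subgroup.mem_carrier[OF assms \<open>Y \<in> A\<close>] .
    with X obtain x y where xy: "X = H #> x" "x \<in> carrier G" "Y = H #> y" "y \<in> carrier G"
      unfolding carrier_FactGroup by blast
    then have "y \<in> \<Union>A" using mem_Union_Mod[OF assms] \<open>Y \<in> A\<close> by simp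
    then have "x \<otimes> y \<otimes> inv x \<in> \<Union>A" using normal.inv_op_closed2[OF N] xy by blast
    then show "X \<otimes>\<^bsub>G Mod H\<^esub> Y \<otimes>\<^bsub>G Mod H\<^esub> inv\<^bsub>G Mod H\<^esub> X \<in> A"
      using xy mem_Union_Mod[OF assms] by (simp only: Mod_conj m_closed inv_closed)
  qed
qed (rule factgroup_subgroup_union_normal)

text \<open>Allows a section to be tested for being Dedekind inside the larger group. This is what
  makes sections of sections comparable without the isomorphism theorems.\<close>

lemma (in normal) dedekind_Mod_iff:
  "dedekind_group (G Mod H) \<longleftrightarrow> (\<forall>A. subgroup A G \<and> H \<subseteq> A \<longrightarrow> A \<lhd> G)"
proof -
  have "dedekind_group (G Mod H) \<longleftrightarrow> (\<forall>A\<in>subgroups (G Mod H). \<Union>A \<lhd> G)"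
    using Mod_normal_iff factorgroup_is_group by (auto simp: dedekind_group_def subgroups_def)
  also have "\<dots> \<longleftrightarrow> (\<forall>A\<in>{A. subgroup A G \<and> H \<subseteq> A}. A \<lhd> G)"
    unfolding bij_betw_imp_surj_on[OF bij_betw_subgroups_Mod, symmetric] by simp
  finally show ?thesis by auto
qed

lemma (in group) dedekind_groupI:
  assumes "nonnormal_subgroups G = {}"
  shows "dedekind_group G"
  using assms is_group by (auto simp: dedekind_group_def nonnormal_subgroups_def)

text \<open>The last two assumptions say that all proper subgroups and all proper quotients are Dedekind.\<close>

locale minimal_non_dedekind = group +
  assumes fin: "finite (carrier G)"
    and ex_nonnormal: "nonnormal_subgroups G \<noteq> {}"
    and normal_in_proper:
      "\<lbrakk>subgroup T G; T \<noteq> carrier G; subgroup A G; A \<subseteq> T; t \<in> T; a \<in> A\<rbrakk> \<Longrightarrow> t \<otimes> a \<otimes> inv t \<in> A"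
    and normal_above: "\<lbrakk>N \<lhd> G; N \<noteq> {\<one>}; subgroup A G; N \<subseteq> A\<rbrakk> \<Longrightarrow> A \<lhd> G"

text \<open>Take a non-Dedekind section \<open>H/K\<close> of least order. Its proper subgroups and
  proper quotients correspond to sections of \<open>G\<close> of smaller order, which are therefore
  Dedekind.\<close>

lemma (in group) ex_minimal_section:
  assumes fin: "finite (carrier G)" and "\<not> dedekind_group G"
  obtains H K where "subgroup H G" "K \<lhd> G\<lparr>carrier := H\<rparr>"
    "minimal_non_dedekind (G\<lparr>carrier := H\<rparr> Mod K)" "order (G\<lparr>carrier := H\<rparr> Mod K) dvd order G"
proof -
  define bad where "bad = (\<lambda>(H, K). subgroup H G \<and> K \<lhd> G\<lparr>carrier := H\<rparr> \<and>
    \<not> dedekind_group (G\<lparr>carrier := H\<rparr> Mod K))"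
  define ord where "ord = (\<lambda>(H, K). order (G\<lparr>carrier := H\<rparr> Mod K))"
  \<comment> \<open>The search starts at \<open>G Mod {\<one>}\<close>, whose elements are
    singletons; it is not literally \<open>G\<close>, so the failure to be Dedekind has to be
    carried over.\<close>
  have "bad (carrier G, {\<one>})"
  proof -
    have "\<not> dedekind_group (G Mod {\<one>})"
      using normal.dedekind_Mod_iff[OF one_is_normal] assms(2) is_group subgroup.one_closed
      by (fastforce simp: dedekind_group_def)
    then show ?thesis using one_is_normal subgroup_self by (simp add: bad_def)
  qed
  then obtain HK where HK: "bad HK" "\<And>HK'. ord HK' < ord HK \<Longrightarrow> \<not> bad HK'"
    using arg_min_natI[of bad] arg_min_nat_le[of bad] by (metis not_le)
  obtain H K where HK_eq: "HK = (H, K)" by fastforce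
  have H: "subgroup H G" and K: "K \<lhd> G\<lparr>carrier := H\<rparr>"
    and nd: "\<not> dedekind_group (G\<lparr>carrier := H\<rparr> Mod K)" using HK by (auto simp: bad_def HK_eq)
  have min: "dedekind_group (G\<lparr>carrier := H'\<rparr> Mod K')"
    if "subgroup H' G" "K' \<lhd> G\<lparr>carrier := H'\<rparr>"
       "order (G\<lparr>carrier := H'\<rparr> Mod K') < order (G\<lparr>carrier := H\<rparr> Mod K)" for H' K'
    using HK(2)[of "(H', K')"] that by (auto simp: bad_def ord_def HK_eq)
  have order_Mod: "order (G\<lparr>carrier := H'\<rparr> Mod K') * card K' = card H'"
    if "subgroup H' G" "K' \<lhd> G\<lparr>carrier := H'\<rparr>" for H' K'
    using group.lagrange[OF subgroup_imp_group[OF that(1)] normal_imp_subgroup[OF that(2)]]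
    by (simp add: FactGroup_def order_def)
  have finH: "finite H" using H fin subgroup.subset finite_subset by metis
  let ?GH = "G\<lparr>carrier := H\<rparr>"
  interpret GH: group ?GH using subgroup_imp_group[OF H] .
  interpret K: normal K ?GH by (rule K)
  let ?Q = "?GH Mod K"
  interpret Q: group ?Q by (rule K.factorgroup_is_group)
  have KH: "K \<subseteq> H" using K.subset by simp
  have finK: "finite K" using KH finH finite_subset by blast
  have cardK: "card K > 0" using finK K.one_closed by (auto simp: card_gt_0_iff)
  have subG: "subgroup A G" if "subgroup A ?GH" for A
    using incl_subgroup[OF H that] .
  have "minimal_non_dedekind ?Q"
  proof (intro minimal_non_dedekind.intro minimal_non_dedekind_axioms.intro Q.is_group)
    show "finite (carrier ?Q)" using finH by (simp add: carrier_FactGroup)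
    show "nonnormal_subgroups ?Q \<noteq> {}" using Q.dedekind_groupI nd by blast
  next
    fix T A X Y
    assume T: "subgroup T ?Q" "T \<noteq> carrier ?Q" and A: "subgroup A ?Q" "A \<subseteq> T" and X: "X \<in> T" and Y: "Y \<in> A"
    let ?T = "\<Union>T"
    have T': "subgroup ?T ?GH" by (rule K.factgroup_subgroup_union_subgroup[OF T(1)])
    have TH: "?T \<subseteq> H" using subgroup.subset[OF T'] by simp
    have "\<Union>(carrier ?Q) = H"
      using K.Union_rcosets_above[OF GH.subgroup_self] KH by (simp add: carrier_FactGroup)
    then have "?T \<noteq> H"
      using K.rcosets_Union_Mod[OF T(1)] K.rcosets_Union_Mod[OF Q.subgroup_self] T(2) by metis
    then have card: "card ?T < card H" using TH finH by (metis psubset_card_mono psubsetI)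
    \<comment> \<open>The subgroup \<open>T\<close> of \<open>H/K\<close> stands for the section
      \<open>?T / K\<close>, which is smaller since \<open>?T\<close> is a proper part of
      \<open>H\<close>.\<close>
    have KT: "K \<lhd> G\<lparr>carrier := ?T\<rparr>"
      using GH.normal_restrict_supergroup[OF T' K K.subset_Union_Mod[OF T(1)]] by simp
    interpret KT: normal K "G\<lparr>carrier := ?T\<rparr>" by (rule KT)
    have "order (G\<lparr>carrier := ?T\<rparr> Mod K) * card K < order ?Q * card K"
      using order_Mod[OF subG[OF T'] KT] order_Mod[OF H K] card by simp
    then have ded: "dedekind_group (G\<lparr>carrier := ?T\<rparr> Mod K)"
      using min[OF subG[OF T'] KT] by simp
    have A': "subgroup (\<Union>A) ?GH" by (rule K.factgroup_subgroup_union_subgroup[OF A(1)])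
    have "subgroup (\<Union>A) (G\<lparr>carrier := ?T\<rparr>)"
      using subgroup_incl[OF subG[OF A'] subG[OF T']] A(2) by blast
    then have AT: "\<Union>A \<lhd> G\<lparr>carrier := ?T\<rparr>"
      using ded K.subset_Union_Mod[OF A(1)] by (simp add: KT.dedekind_Mod_iff)
    obtain x y where xy: "X = K #>\<^bsub>?GH\<^esub> x" "x \<in> carrier ?GH" "Y = K #>\<^bsub>?GH\<^esub> y" "y \<in> carrier ?GH"
      using subgroup.mem_carrier[OF T(1) X] subgroup.mem_carrier[OF A(1) Y]
      unfolding carrier_FactGroup by blast
    have mem: "x \<in> ?T" "y \<in> \<Union>A"
      using K.mem_Union_Mod[OF T(1)] K.mem_Union_Mod[OF A(1)] X Y xy by blast+
    have "x \<otimes> y \<otimes> inv x \<in> \<Union>A"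
      using normal.inv_op_closed2[OF AT, of x y] mem m_inv_consistent[OF subG[OF T'] mem(1)] by simp
    then have "x \<otimes>\<^bsub>?GH\<^esub> y \<otimes>\<^bsub>?GH\<^esub> inv\<^bsub>?GH\<^esub> x \<in> \<Union>A"
      using m_inv_consistent[OF H, of x] xy by simp
    then have "K #>\<^bsub>?GH\<^esub> (x \<otimes>\<^bsub>?GH\<^esub> y \<otimes>\<^bsub>?GH\<^esub> inv\<^bsub>?GH\<^esub> x) \<in> A"
      using K.mem_Union_Mod[OF A(1)] GH.m_closed GH.inv_closed xy(2,4) by simp
    then show "X \<otimes>\<^bsub>?Q\<^esub> Y \<otimes>\<^bsub>?Q\<^esub> inv\<^bsub>?Q\<^esub> X \<in> A"
      using K.Mod_conj[of x y] xy by simp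
  next
    fix N A
    assume N: "N \<lhd> ?Q" "N \<noteq> {\<one>\<^bsub>?Q\<^esub>}" and A: "subgroup A ?Q" "N \<subseteq> A"
    have sN: "subgroup N ?Q" using N(1) by (rule normal_imp_subgroup)
    have N': "\<Union>N \<lhd> ?GH" by (rule K.factgroup_subgroup_union_normal[OF N(1)])
    interpret N: normal "\<Union>N" ?GH by (rule N')
    \<comment> \<open>The quotient of \<open>H/K\<close> by \<open>N\<close> stands for the section
      \<open>H / \<Union>N\<close>. It is smaller because \<open>N\<close> is nontrivial, so that
      \<open>\<Union>N\<close> properly contains \<open>K\<close>.\<close>
    have "\<Union>N \<noteq> K"
    proof
      assume "\<Union>N = K"
      then have "N = (\<lambda>x. K #>\<^bsub>?GH\<^esub> x) ` K" using K.rcosets_Union_Mod[OF sN] by simp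
      moreover have "{\<one>\<^bsub>?Q\<^esub>} = (\<lambda>x. K #>\<^bsub>?GH\<^esub> x) ` K"
        using K.rcosets_Union_Mod[OF Q.triv_subgroup] by simp
      ultimately show False using N(2) by simp
    qed
    then have "card K < card (\<Union>N)"
      using K.subset_Union_Mod[OF sN] finite_subset[OF N.subset] finH by (auto intro!: psubset_card_mono)
    moreover have "order (?GH Mod \<Union>N) * card (\<Union>N) = order ?Q * card K" "order ?Q * card K > 0"
      using order_Mod[OF H N'] order_Mod[OF H K] finH subgroup.one_closed[OF H] by (auto simp: card_gt_0_iff)
    ultimately have "order (?GH Mod \<Union>N) < order ?Q"
    proof -
      assume a: "card K < card (\<Union>N)"
        "order (?GH Mod \<Union>N) * card (\<Union>N) = order ?Q * card K" "order ?Q * card K > 0"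
      have "order ?Q * card K < order ?Q * card (\<Union>N)" using a(1,3) by simp
      then show ?thesis using a(2) by (metis mult_less_cancel2)
    qed
    then have "dedekind_group (?GH Mod \<Union>N)" using min[OF H N'] by simp
    moreover have "subgroup (\<Union>A) ?GH" by (rule K.factgroup_subgroup_union_subgroup[OF A(1)])
    ultimately have "\<Union>A \<lhd> ?GH" using A(2) by (auto simp: N.dedekind_Mod_iff)
    then show "A \<lhd> ?Q" using K.Mod_normal_iff[OF A(1)] by simp
  qed
  moreover have "order ?Q dvd order G"
    using order_Mod[OF H K] lagrange[OF H] by (metis dvd_triv_left dvd_triv_right dvd_trans order_def)
  ultimately show ?thesis using that H K by blast
qed

section \<open>Sections and invariance under isomorphism\<close>

lemma (in group) finite_sections:
  assumes "finite (carrier G)"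
  shows "finite {d_prime (G\<lparr>carrier := H\<rparr> Mod K) |H K. subgroup H G \<and> K \<lhd> G\<lparr>carrier := H\<rparr>}"
proof (rule finite_subset)
  show "{d_prime (G\<lparr>carrier := H\<rparr> Mod K) |H K. subgroup H G \<and> K \<lhd> G\<lparr>carrier := H\<rparr>} \<subseteq>
      (\<lambda>(H, K). d_prime (G\<lparr>carrier := H\<rparr> Mod K)) ` (Pow (carrier G) \<times> Pow (carrier G))"
  proof clarify
    fix H K assume H: "subgroup H G" and K: "K \<lhd> G\<lparr>carrier := H\<rparr>"
    have "H \<subseteq> carrier G" "K \<subseteq> carrier G"
      using subgroup.subset[OF H] subgroup.subset[OF normal_imp_subgroup[OF K]] by auto
    then show "d_prime (G\<lparr>carrier := H\<rparr> Mod K) \<in>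
        (\<lambda>(H, K). d_prime (G\<lparr>carrier := H\<rparr> Mod K)) ` (Pow (carrier G) \<times> Pow (carrier G))"
      by (intro image_eqI[of _ _ "(H, K)"]) auto
  qed
qed (use assms in simp)

lemma (in group) d_star_le:
  assumes "finite (carrier G)" "subgroup H G" "K \<lhd> G\<lparr>carrier := H\<rparr>"
  shows "d_star G \<le> d_prime (G\<lparr>carrier := H\<rparr> Mod K)"
  unfolding d_star_def by (rule Min_le[OF finite_sections[OF assms(1)]]) (use assms in blast)

lemma (in group_hom) conj_image:
  assumes "A \<subseteq> carrier G" "g \<in> carrier G"
  shows "h ` (g <# A #> inv g) = h g <#\<^bsub>H\<^esub> h ` A #>\<^bsub>H\<^esub> inv\<^bsub>H\<^esub> (h g)"
proof -
  have "h (g \<otimes> a \<otimes> inv g) = h g \<otimes>\<^bsub>H\<^esub> h a \<otimes>\<^bsub>H\<^esub> inv\<^bsub>H\<^esub> (h g)" if "a \<in> A" for a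
    using that assms by auto
  then show ?thesis using assms by (force simp: l_coset_def r_coset_def image_UN)
qed

lemma orbit_image: "orbit G \<phi> x = (\<lambda>g. \<phi> g x) ` carrier G"
  by (auto simp: orbit_def)

text \<open>Needed for the section \<open>G Mod {\<one>}\<close>, which is only isomorphic to
  \<open>G\<close>. An isomorphism acts on subgroups by images and on classes by images of images,
  both injectively.\<close>

lemma d_prime_iso:
  assumes "group G" "group H" "f \<in> iso G H"
  shows "d_prime G = d_prime H"
proof -
  interpret f: group_hom G H f
    using assms by (simp add: group_hom_def group_hom_axioms_def iso_def)
  have bij: "bij_betw f (carrier G) (carrier H)" using assms(3) by (simp add: iso_def)
  then have inj: "inj_on f (carrier G)" and surj: "f ` carrier G = carrier H" by (auto simp: bij_betw_def)
  have inj_sub: "inj_on ((`) f) (Pow (carrier G))" by (rule inj_on_image_Pow[OF inj])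
  have sub: "subgroups G \<subseteq> Pow (carrier G)" by (auto simp: subgroups_def dest: subgroup.subset)
  have subs: "subgroups H = (`) f ` subgroups G"
  proof
    show "(`) f ` subgroups G \<subseteq> subgroups H"
      by (auto simp: subgroups_def f.subgroup_img_is_subgroup)
    show "subgroups H \<subseteq> (`) f ` subgroups G"
    proof
      fix B assume "B \<in> subgroups H"
      then have B: "subgroup B H" by (simp add: subgroups_def)
      let ?A = "{x \<in> carrier G. f x \<in> B}"
      have "subgroup ?A G"
      proof (rule f.G.subgroupI)
        have "\<one>\<^bsub>G\<^esub> \<in> ?A" using subgroup.one_closed[OF B] by simp
        then show "?A \<noteq> {}" by blast
      qed (auto simp: subgroup.m_closed[OF B] subgroup.m_inv_closed[OF B])
      moreover have "f ` ?A = B" using surj subgroup.subset[OF B] by auto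
      ultimately show "B \<in> (`) f ` subgroups G" by (auto simp: subgroups_def)
    qed
  qed
  have cls: "conj_class H (f ` A) = (`) f ` conj_class G A" if "A \<in> subgroups G" for A
  proof -
    have "A \<subseteq> carrier G" using that sub by blast
    then have "(`) f ` conj_class G A = {f g <#\<^bsub>H\<^esub> f ` A #>\<^bsub>H\<^esub> inv\<^bsub>H\<^esub> (f g) | g. g \<in> carrier G}"
      by (simp add: orbit_image image_image f.conj_image setcompr_eq_image cong: image_cong_simp)
    also have "\<dots> = conj_class H (f ` A)"
      by (simp add: orbit_image surj[symmetric] image_image setcompr_eq_image)
    finally show ?thesis by simp
  qed
  have "subgroup_classes H = (`) ((`) f) ` subgroup_classes G"
    by (auto simp: f.G.subgroup_classes_eq f.H.subgroup_classes_eq subs cls image_image)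
  moreover have "subgroup_classes G \<subseteq> Pow (Pow (carrier G))"
    by (auto simp: f.G.subgroup_classes_eq subgroups_def orbit_def r_coset_def l_coset_def dest: subgroup.mem_carrier)
  then have "inj_on ((`) ((`) f)) (subgroup_classes G)"
    using inj_on_image_Pow[OF inj_sub] inj_on_subset by blast
  moreover have "inj_on ((`) f) (subgroups G)" using inj_sub sub inj_on_subset by blast
  ultimately show ?thesis by (simp add: d_prime_def subs card_image)
qed

text \<open>Every section other than \<open>G Mod {\<one>}\<close> is Dedekind, by
  \<open>normal_in_proper\<close> if \<open>H\<close> is proper and by \<open>normal_above\<close>
  if \<open>K\<close> is nontrivial. It thus has the maximal value 1.\<close>

lemma (in minimal_non_dedekind) d_star_eq: "d_star G = d_prime G"
  unfolding d_star_def
proof (rule Min_eqI)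
  have triv: "d_prime (G Mod {\<one>}) = d_prime G"
    by (rule d_prime_iso[OF normal.factorgroup_is_group[OF one_is_normal] is_group trivial_factor_iso])
  show "d_prime G \<in> {d_prime (G\<lparr>carrier := H\<rparr> Mod K) |H K. subgroup H G \<and> K \<lhd> G\<lparr>carrier := H\<rparr>}"
    by (intro CollectI exI[of _ "carrier G"] exI[of _ "{\<one>}"]) (simp add: triv subgroup_self one_is_normal)
  show "finite {d_prime (G\<lparr>carrier := H\<rparr> Mod K) |H K. subgroup H G \<and> K \<lhd> G\<lparr>carrier := H\<rparr>}"
    by (rule finite_sections[OF fin])
  fix d assume "d \<in> {d_prime (G\<lparr>carrier := H\<rparr> Mod K) |H K. subgroup H G \<and> K \<lhd> G\<lparr>carrier := H\<rparr>}"
  then obtain H K where d: "d = d_prime (G\<lparr>carrier := H\<rparr> Mod K)"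
    and H: "subgroup H G" and K: "K \<lhd> G\<lparr>carrier := H\<rparr>" by blast
  show "d_prime G \<le> d"
  proof (cases "H = carrier G \<and> K = {\<one>}")
    case True
    then show ?thesis using triv d by simp
  next
    case False
    interpret K: normal K "G\<lparr>carrier := H\<rparr>" by (rule K)
    have "A \<lhd> G\<lparr>carrier := H\<rparr>" if A: "subgroup A (G\<lparr>carrier := H\<rparr>)" "K \<subseteq> A" for A
    proof (cases "H = carrier G")
      case True
      then show ?thesis using normal_above[of K A] A K False by simp
    next
      case False
      have "t \<otimes> a \<otimes> inv t \<in> A" if "t \<in> H" "a \<in> A" for t a
        using normal_in_proper[OF H False incl_subgroup[OF H A(1)]] subgroup.subset[OF A(1)] that by simp
      then show ?thesis
        by (intro K.normal_invI A(1)) (simp add: m_inv_consistent[OF H])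
    qed
    then have "dedekind_group (G\<lparr>carrier := H\<rparr> Mod K)" by (simp add: K.dedekind_Mod_iff)
    moreover have "finite H" using H fin subgroup.subset finite_subset by metis
    then have "finite (carrier (G\<lparr>carrier := H\<rparr> Mod K))" by (simp add: carrier_FactGroup)
    ultimately have "d = 1" using d group.d_prime_dedekind[OF K.factorgroup_is_group] by simp
    then show ?thesis using d_prime_le_1[OF fin] by simp
  qed
qed

subsection \<open>Minimal non-Dedekind \<open>p\<close>-groups\<close>

lemma (in group) commute_int_pow:
  assumes "x \<otimes> y = y \<otimes> x" "x \<in> carrier G" "y \<in> carrier G"
  shows "x [^] (i::int) \<otimes> y = y \<otimes> x [^] i"
proof (cases i rule: int_cases2)
  case (nonneg n)
  then show ?thesis using assms group_commutes_pow[of x y n] by (simp add: int_pow_int)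
next
  case (nonpos n)
  have "x [^] n \<otimes> y = y \<otimes> x [^] n" using assms group_commutes_pow[of x y n] by simp
  then have "inv (x [^] n) \<otimes> y = y \<otimes> inv (x [^] n)"
    using assms by (metis inv_closed inv_solve_left inv_solve_right m_assoc m_closed nat_pow_closed)
  then show ?thesis using nonpos assms by (simp add: int_pow_neg int_pow_int)
qed

lemma (in group) commute_int_pow_int_pow:
  assumes "x \<otimes> y = y \<otimes> x" "x \<in> carrier G" "y \<in> carrier G"
  shows "x [^] (i::int) \<otimes> y [^] (j::int) = y [^] j \<otimes> x [^] i"
  using commute_int_pow[of y "x [^] i" j] commute_int_pow[of x y i] assms by simp

lemma (in group) conj_int_pow:
  assumes "g \<in> carrier G" "x \<in> carrier G"
  shows "g \<otimes> x [^] (i::int) \<otimes> inv g = (g \<otimes> x \<otimes> inv g) [^] i"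
proof -
  have hom: "(\<lambda>x. g \<otimes> x \<otimes> inv g) \<in> hom G G"
    using assms(1) by (auto simp: hom_def m_assoc) (metis inv_closed l_inv l_one m_assoc m_closed)
  show ?thesis using hom_int_pow[OF hom assms(2) is_group is_group] .
qed

lemma (in group) generate_singleton_mem_iff:
  assumes "x \<in> carrier G"
  shows "y \<in> generate G {x} \<longleftrightarrow> (\<exists>i::int. y = x [^] i)"
  using generate_pow[OF assms] by auto

lemma (in group) generate_singleton_subset:
  assumes "subgroup A G" "x \<in> A"
  shows "generate G {x} \<subseteq> A"
  using generate_subgroup_incl[of "{x}" A] assms by simp

text \<open>Bezout: if \<open>u i + v p = 1\<close>, then \<open>x\<close> is the
  \<open>u\<close>-th power of \<open>x^i\<close>.\<close>

lemma (in group) prime_ord_coprime_pow: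
  assumes "x \<in> carrier G" "prime p" "ord x = p" "\<not> int p dvd i" "subgroup A G" "x [^] (i::int) \<in> A"
  shows "x \<in> A"
proof -
  have "prime (int p)" using assms(2) by simp
  then have "coprime i (int p)"
    using prime_imp_coprime[OF _ assms(4)] by (simp add: coprime_commute)
  then obtain u v where uv: "u * i + v * int p = 1"
    using bezout_int[of i "int p"] by (metis coprime_imp_gcd_eq_1)
  have "(x [^] i) [^] u = x [^] (u * i)" using assms(1) by (simp add: int_pow_pow mult.commute)
  also have "\<dots> = x [^] (1::int)"
    unfolding int_pow_eq[OF assms(1)] assms(3) using uv by (metis add_diff_cancel_left' dvd_triv_right)
  finally have "(x [^] i) [^] u = x" using assms(1) by simp
  then show ?thesis using subgroup_int_pow_closed[OF assms(5,6), of u] by simp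
qed

lemma (in group) central_generate_normal:
  assumes "z \<in> carrier G" "\<And>x. x \<in> carrier G \<Longrightarrow> x \<otimes> z = z \<otimes> x"
  shows "generate G {z} \<lhd> G"
proof (rule normal_invI)
  show "subgroup (generate G {z}) G" using assms by (intro generate_is_subgroup) auto
  fix x h assume x: "x \<in> carrier G" and "h \<in> generate G {z}"
  then obtain i :: int where h: "h = z [^] i" using generate_singleton_mem_iff assms(1) by blast
  have "x \<otimes> z \<otimes> inv x = z" using assms x by (simp add: m_assoc)
  then have "x \<otimes> h \<otimes> inv x = h" using conj_int_pow[OF x assms(1), of i] h by simp
  then show "x \<otimes> h \<otimes> inv x \<in> generate G {z}" using \<open>h \<in> generate G {z}\<close> by simp
qed

text \<open>The order of \<open>g\<close> is deliberately left open: in \<open>D\<^sub>8\<close>,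
  for a reflection \<open>k\<close>, both a rotation of order 4 and another reflection can serve as
  \<open>g\<close>. Only the order of \<open>g\<close> modulo \<open>z\<close> enters the
  counting.\<close>

locale minimal_non_dedekind_p_group = minimal_non_dedekind +
  fixes p m :: nat and k g z
  assumes prime_p: "prime p" and order_G: "order G = p ^ m"
    and k: "k \<in> carrier G" and g: "g \<in> carrier G" and z: "z \<in> carrier G"
    and ord_k: "ord k = p" and ord_z: "ord z = p"
    and central: "\<And>x. x \<in> carrier G \<Longrightarrow> x \<otimes> z = z \<otimes> x"
    and conj_k: "g \<otimes> k \<otimes> inv g = k \<otimes> z"
    and generated: "generate G {k, g} = carrier G"

text \<open>The element \<open>k\<close> comes from an arbitrary non-normal subgroup,
  \<open>g\<close> from the failure of \<open><k>\<close> to be normal, and \<open>z\<close> is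
  their commutator. The work lies in placing \<open>z\<close> in a central subgroup
  \<open>?Z\<close> of order \<open>p\<close>; being nontrivial, it then has order
  \<open>p\<close>.\<close>

lemma (in minimal_non_dedekind) ex_p_group_structure:
  assumes p: "prime p" and ord_G: "order G = p ^ m"
  shows "\<exists>k g z. minimal_non_dedekind_p_group G p m k g z"
proof -
  obtain H where H: "subgroup H G" "\<not> H \<lhd> G"
    using ex_nonnormal by (auto simp: nonnormal_subgroups_def)
  have "H \<noteq> {\<one>}" using H one_is_normal by auto
  then obtain h where h: "h \<in> H" "h \<noteq> \<one>" using subgroup.one_closed[OF H(1)] by blast
  have hc: "h \<in> carrier G" using subgroup.mem_carrier[OF H(1) h(1)] .
  obtain n1 :: nat where "ord (h [^] n1) = p" using p_group_power_of_order_p[OF p ord_G hc h(2)] .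
  define k where "k = h [^] n1"
  have k: "k \<in> carrier G" "ord k = p" using hc \<open>ord (h [^] n1) = p\<close> by (auto simp: k_def)
  have kH: "k \<in> H" using subgroup_int_pow_closed[OF H(1) h(1), of "int n1"] by (simp add: k_def int_pow_int)
  have p1: "p \<noteq> 1" using p by auto
  have k1: "k \<noteq> \<one>" using k p1 ord_eq_1 by auto
  let ?K = "generate G {k}"
  have subK: "subgroup ?K G" using k by (intro generate_is_subgroup) auto
  have k_in: "k \<in> ?K" by (simp add: generate.incl)
  \<comment> \<open>If \<open>?K\<close> were normal, \<open>normal_above\<close> would make the
    larger subgroup \<open>H\<close> normal as well.\<close>
  have nK: "\<not> ?K \<lhd> G"
    using normal_above[OF _ _ H(1) generate_singleton_subset[OF H(1) kH]] H(2) k_in k1 by blast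
  then obtain g y where g: "g \<in> carrier G" and y: "y \<in> ?K" "g \<otimes> y \<otimes> inv g \<notin> ?K"
    using normal_inv_iff subK by blast
  have gk: "g \<otimes> k \<otimes> inv g \<notin> ?K"
  proof
    assume "g \<otimes> k \<otimes> inv g \<in> ?K"
    obtain i :: int where "y = k [^] i" using y(1) generate_singleton_mem_iff[OF k(1)] by blast
    then show False
      using y(2) subgroup_int_pow_closed[OF subK \<open>g \<otimes> k \<otimes> inv g \<in> ?K\<close>, of i] conj_int_pow[OF g k(1), of i] by simp
  qed
  \<comment> \<open>In a proper subgroup containing both elements, \<open>g\<close> would normalise
    \<open>?K\<close>.\<close>
  have gen: "generate G {k, g} = carrier G"
  proof (rule ccontr)
    assume "generate G {k, g} \<noteq> carrier G"
    moreover have T: "subgroup (generate G {k, g}) G" using k g by (intro generate_is_subgroup) auto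
    moreover have "?K \<subseteq> generate G {k, g}" by (rule mono_generate) auto
    ultimately show False
      using normal_in_proper[OF T _ subK _ _ k_in, of g] gk by (auto simp: generate.incl)
  qed
  have "m > 0" using ord_G k1 k(1) order_one_triv_iff by (cases m) auto
  then obtain z0 where z0: "z0 \<in> carrier G" "z0 \<noteq> \<one>" "\<And>x. x \<in> carrier G \<Longrightarrow> x \<otimes> z0 = z0 \<otimes> x"
    using p_group_central_element[OF p ord_G] by blast
  obtain n0 :: nat where "ord (z0 [^] n0) = p" using p_group_power_of_order_p[OF p ord_G z0(1,2)] .
  define z1 where "z1 = z0 [^] n0"
  have z1: "z1 \<in> carrier G" "ord z1 = p" using z0 \<open>ord (z0 [^] n0) = p\<close> by (auto simp: z1_def)
  have z1c: "x \<otimes> z1 = z1 \<otimes> x" if "x \<in> carrier G" for x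
    using group_commutes_pow[of z0 x n0] z0 that by (simp add: z1_def)
  let ?Z = "generate G {z1}"
  have Zn: "?Z \<lhd> G" by (rule central_generate_normal[OF z1(1) z1c])
  interpret Z: normal ?Z G by (rule Zn)
  have z1_in: "z1 \<in> ?Z" by (simp add: generate.incl)
  have Zc: "x \<otimes> w = w \<otimes> x" if "x \<in> carrier G" "w \<in> ?Z" for x w
  proof -
    obtain i :: int where "w = z1 [^] i" using \<open>w \<in> ?Z\<close> generate_singleton_mem_iff[OF z1(1)] by blast
    then show ?thesis using commute_int_pow[of z1 x i] z1c z1(1) that(1) by simp
  qed
  let ?Q = "G Mod ?Z"
  interpret Q: group ?Q by (rule Z.factorgroup_is_group)
  have "order ?Q * card ?Z = p ^ m"
    using lagrange[OF Z.is_subgroup] ord_G by (simp add: FactGroup_def order_def)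
  then obtain m' where ordQ: "order ?Q = p ^ m'" using divides_primepow_nat[OF p] by (metis dvd_triv_left)
  have kZ_normal: "(?Z <#> ?K) \<lhd> G"
  proof (rule normal_above[OF Zn])
    show "?Z \<noteq> {\<one>}" using z1_in z1(2) p1 ord_eq_1[OF z1(1)] by auto
    show "subgroup (?Z <#> ?K) G" by (rule mult_norm_subgroup[OF Zn subK])
    show "?Z \<subseteq> ?Z <#> ?K" using subgroup.one_closed[OF subK] Z.subset by (force simp: set_mult_def)
  qed
  have "\<one> \<otimes> k \<in> ?Z <#> ?K" using Z.one_closed k_in unfolding set_mult_def by blast
  then have k_ZK: "k \<in> ?Z <#> ?K" using k(1) by simp
  let ?c = "\<lambda>x. \<lambda>y\<in>carrier ?Q. x \<otimes>\<^bsub>?Q\<^esub> y \<otimes>\<^bsub>?Q\<^esub> inv\<^bsub>?Q\<^esub> x"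
  let ?k = "?Z #> k"
  interpret act: group_action ?Q "carrier ?Q" ?c by (rule Q.action_by_conjugation)
  have kQ: "?k \<in> carrier ?Q" using k by (auto simp: carrier_FactGroup)
  \<comment> \<open>Normality of \<open>?Z <#> ?K\<close> confines the conjugates of
    \<open>?k\<close> to the cosets of powers of \<open>k\<close>. With exponent 0 excluded at most
    \<open>p - 1\<close> remain, too few for a nontrivial orbit.\<close>
  have orb: "orbit ?Q ?c ?k \<subseteq> (\<lambda>i. ?Z #> k [^] i) ` {1..<int p}"
  proof
    fix X assume "X \<in> orbit ?Q ?c ?k"
    then obtain x where x: "x \<in> carrier G" "X = ?Z #> (x \<otimes> k \<otimes> inv x)"
      using Z.Mod_conj k(1) kQ by (auto simp: orbit_def carrier_FactGroup)
    have "x \<otimes> k \<otimes> inv x \<in> ?Z <#> ?K" using normal.inv_op_closed2[OF kZ_normal x(1) k_ZK] .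
    then obtain w i where w: "w \<in> ?Z" "x \<otimes> k \<otimes> inv x = w \<otimes> k [^] (i::int)"
      using generate_singleton_mem_iff[OF k(1)] by (auto simp: set_mult_def)
    have ki: "k [^] i = k [^] (i mod int p)"
      unfolding int_pow_eq[OF k(1)] k(2) by (metis dvd_minus_mod minus_diff_eq dvd_minus_iff)
    have "X = ?Z #> k [^] i"
      using x w k(1) Z.mem_carrier[OF w(1)] coset_mult_assoc[OF Z.subset, of w "k [^] i"] coset_join2[OF _ Z.is_subgroup w(1)] by simp
    \<comment> \<open>Exponent 0 would put a conjugate of \<open>k\<close>, and hence
      \<open>k\<close> itself, into the central subgroup \<open>?Z\<close>; but \<open>g\<close>
      does not commute with \<open>k\<close>.\<close>
    moreover have "i mod int p \<noteq> 0"
    proof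
      assume "i mod int p = 0"
      then have "x \<otimes> k \<otimes> inv x = w" using w ki Z.mem_carrier by simp
      then have "k = inv x \<otimes> w \<otimes> x" using x k(1) w(1)
        by (metis Z.mem_carrier inv_closed inv_solve_left inv_solve_right m_assoc m_closed)
      then have "k = w" using Zc[OF x(1) w(1)] x(1) Z.mem_carrier[OF w(1)]
        by (simp add: m_assoc flip: Zc) (metis inv_closed l_inv l_one m_assoc)
      then have "g \<otimes> k \<otimes> inv g = k" using Zc[OF g w(1)] g k(1) by (simp add: m_assoc)
      then show False using gk k_in by simp
    qed
    moreover have "0 \<le> i mod int p" "i mod int p < int p" using p by (auto simp: prime_gt_0_nat)
    ultimately show "X \<in> (\<lambda>i. ?Z #> k [^] i) ` {1..<int p}" using ki by (intro image_eqI[of _ _ "i mod int p"]) auto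
  qed
  then have "card (orbit ?Q ?c ?k) \<le> card {1..<int p}"
    by (intro surj_card_le) auto
  also have "\<dots> < p" using prime_gt_0_nat[OF p] by simp
  finally have card_lt: "card (orbit ?Q ?c ?k) < p" .
  have "finite (orbit ?Q ?c ?k)" using orb finite_subset by blast
  then have card_pos: "card (orbit ?Q ?c ?k) > 0" using act.orbit_refl[OF kQ] by (auto simp: card_gt_0_iff)
  have "orbit ?Q ?c ?k = {?k}"
  proof (rule ccontr)
    assume "orbit ?Q ?c ?k \<noteq> {?k}"
    then have "p dvd card (orbit ?Q ?c ?k)" by (rule act.card_orbit_prime_power[OF p ordQ kQ])
    then show False using dvd_imp_le[OF _ card_pos, of p] card_lt by simp
  qed
  moreover have "?Z #> (g \<otimes> k \<otimes> inv g) \<in> orbit ?Q ?c ?k"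
    unfolding orbit_image using Z.Mod_conj[OF g k(1)] kQ g
    by (intro image_eqI[of _ _ "?Z #> g"]) (auto simp: carrier_FactGroup)
  ultimately have "?Z #> (g \<otimes> k \<otimes> inv g) = ?Z #> k" by simp
  then have "g \<otimes> k \<otimes> inv g \<in> ?Z #> k"
    using rcos_self[OF _ Z.is_subgroup, of "g \<otimes> k \<otimes> inv g"] g k(1) by simp
  then obtain z where z: "z \<in> ?Z" "g \<otimes> k \<otimes> inv g = z \<otimes> k" by (auto simp: r_coset_def)
  have zc: "z \<in> carrier G" using Z.mem_carrier[OF z(1)] .
  have "z \<noteq> \<one>" using z(2) gk k_in k(1) by auto
  obtain i :: int where "z = z1 [^] i" using z(1) generate_singleton_mem_iff[OF z1(1)] by blast
  then have "z [^] int p = \<one>" using z1 by (simp add: int_pow_pow int_pow_eq_id)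
  then have "ord z dvd p" using int_pow_eq_id[OF zc] by simp
  then have "ord z = p" using p \<open>z \<noteq> \<one>\<close> ord_eq_1[OF zc] by (metis prime_nat_iff)
  then have "minimal_non_dedekind_p_group G p m k g z"
    using p ord_G k g zc Zc[OF _ z(1)] z(2) gen
    by unfold_locales auto
  then show ?thesis by blast
qed

lemma (in group) centralizer_subgroup:
  assumes x: "x \<in> carrier G"
  shows "subgroup {y \<in> carrier G. x \<otimes> y = y \<otimes> x} G"
proof (rule subgroupI)
  show "{y \<in> carrier G. x \<otimes> y = y \<otimes> x} \<noteq> {}" using x by auto
  show "inv y \<in> {y \<in> carrier G. x \<otimes> y = y \<otimes> x}" if "y \<in> {y \<in> carrier G. x \<otimes> y = y \<otimes> x}" for y
    using that x commute_int_pow[of y x "-1"] by (simp add: int_pow_neg)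
  show "y \<otimes> y' \<in> {y \<in> carrier G. x \<otimes> y = y \<otimes> x}"
    if "y \<in> {y \<in> carrier G. x \<otimes> y = y \<otimes> x}" "y' \<in> {y \<in> carrier G. x \<otimes> y = y \<otimes> x}" for y y'
  proof -
    have "x \<otimes> (y \<otimes> y') = (x \<otimes> y) \<otimes> y'"
      by (rule m_assoc[symmetric]) (use that x in auto)
    also have "\<dots> = (y \<otimes> x) \<otimes> y'" using that by simp
    also have "\<dots> = y \<otimes> (x \<otimes> y')" using that x by (simp add: m_assoc)
    also have "\<dots> = y \<otimes> y' \<otimes> x" using that x by (simp add: m_assoc)
    finally show ?thesis using that by simp
  qed
qed auto

context minimal_non_dedekind_p_group
begin

lemma p_gt_1: "p > 1"
  using prime_gt_1_nat[OF prime_p] .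

lemma z_ne_1: "z \<noteq> \<one>"
  using ord_z p_gt_1 ord_eq_1[OF z] by auto

lemma not_commute: "g \<otimes> k \<noteq> k \<otimes> g"
proof
  assume "g \<otimes> k = k \<otimes> g"
  then have "k = k \<otimes> z" using conj_k k g by (simp add: m_assoc)
  then show False using z_ne_1 k z by simp
qed

lemma Z_normal: "generate G {z} \<lhd> G"
  by (rule central_generate_normal[OF z central])

lemma Z_subset_iff: "subgroup A G \<Longrightarrow> generate G {z} \<subseteq> A \<longleftrightarrow> z \<in> A"
  using generate_singleton_subset generate.incl[of z "{z}" G] by blast

lemma normal_if_z_mem: "\<lbrakk>subgroup A G; z \<in> A\<rbrakk> \<Longrightarrow> A \<lhd> G"
  using normal_above[OF Z_normal] Z_subset_iff z_ne_1 generate.incl[of z "{z}" G] by blast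

text \<open>Since \<open>A <#> <k>\<close> contains \<open>A\<close>, it is normal and so contains
  the commutator \<open>z\<close>, say \<open>z = a k^i\<close> with \<open>a\<close> in
  \<open>A\<close>. If \<open>p\<close> divides \<open>i\<close>, then \<open>z = a\<close>.
  Otherwise the commutator of \<open>a\<close> with \<open>g\<close> is \<open>z^(-i)\<close>, which
  lies in \<open>A\<close> and generates \<open><z>\<close>.\<close>

lemma z_mem_if_normal:
  assumes A: "A \<lhd> G" "A \<noteq> {\<one>}"
  shows "z \<in> A"
proof -
  let ?K = "generate G {k}"
  have sA: "subgroup A G" using A(1) by (rule normal_imp_subgroup)
  have subK: "subgroup ?K G" using k by (intro generate_is_subgroup) auto
  have k_in: "k \<in> ?K" by (simp add: generate.incl)
  have sB: "subgroup (A <#> ?K) G" by (rule mult_norm_subgroup[OF A(1) subK])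
  have "A \<subseteq> A <#> ?K"
  proof
    fix a assume "a \<in> A"
    then have "a \<otimes> \<one> \<in> A <#> ?K" unfolding set_mult_def using subgroup.one_closed[OF subK] by blast
    then show "a \<in> A <#> ?K" using subgroup.mem_carrier[OF sA \<open>a \<in> A\<close>] by simp
  qed
  then have B: "A <#> ?K \<lhd> G" using normal_above[OF A sB] by simp
  have "\<one> \<otimes> k \<in> A <#> ?K" unfolding set_mult_def using subgroup.one_closed[OF sA] k_in by blast
  then have kB: "k \<in> A <#> ?K" using k by simp
  have "inv k \<otimes> (g \<otimes> k \<otimes> inv g) \<in> A <#> ?K"
    using subgroup.m_closed[OF sB subgroup.m_inv_closed[OF sB kB] normal.inv_op_closed2[OF B g kB]] .
  moreover have "inv k \<otimes> (g \<otimes> k \<otimes> inv g) = z"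
    unfolding conj_k using k z by (simp flip: m_assoc)
  ultimately obtain a i where a: "a \<in> A" "z = a \<otimes> k [^] (i::int)"
    using generate_singleton_mem_iff[OF k] by (auto simp: set_mult_def)
  have ac: "a \<in> carrier G" using subgroup.mem_carrier[OF sA a(1)] .
  show ?thesis
  proof (cases "int p dvd i")
    case True
    then have "k [^] i = \<one>" using int_pow_eq_id[OF k] ord_k by simp
    then show ?thesis using a ac by simp
  next
    case False
    have a_eq: "a = z \<otimes> k [^] (-i)" using a(2) ac k z by (simp add: int_pow_neg inv_solve_right)
    have gz: "g \<otimes> z \<otimes> inv g = z" using central[OF g] g z by (simp add: m_assoc)
    have "g \<otimes> a \<otimes> inv g = (g \<otimes> z \<otimes> inv g) \<otimes> (g \<otimes> k [^] (-i) \<otimes> inv g)"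
      unfolding a_eq using g k z by (simp add: m_assoc) (metis g inv_closed l_inv l_one m_assoc m_closed int_pow_closed)
    also have "\<dots> = z \<otimes> (k \<otimes> z) [^] (-i)"
      using conj_int_pow[OF g k, of "-i"] gz conj_k by simp
    also have "\<dots> = a \<otimes> z [^] (-i)"
      unfolding a_eq using int_pow_mult_distrib[OF central[OF k] k z, of "-i"] k z by (simp add: m_assoc)
    finally have "inv a \<otimes> (g \<otimes> a \<otimes> inv g) = z [^] (-i)" using ac z by (simp flip: m_assoc)
    moreover have "inv a \<otimes> (g \<otimes> a \<otimes> inv g) \<in> A"
      using subgroup.m_closed[OF sA subgroup.m_inv_closed[OF sA a(1)] normal.inv_op_closed2[OF A(1) g a(1)]] .
    ultimately show ?thesis
      using prime_ord_coprime_pow[OF z prime_p ord_z _ sA, of "-i"] False by simp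
  qed
qed

lemma normal_iff: "A \<lhd> G \<longleftrightarrow> A = {\<one>} \<or> (subgroup A G \<and> z \<in> A)"
  using z_mem_if_normal normal_if_z_mem one_is_normal normal_imp_subgroup by blast

text \<open>A normal \<open><k>\<close> would contain \<open>z\<close>; both having order
  \<open>p\<close>, \<open>k\<close> would be a power of the central \<open>z\<close>.\<close>

lemma k_nonnormal: "\<not> generate G {k} \<lhd> G"
proof
  assume "generate G {k} \<lhd> G"
  moreover have "k \<noteq> \<one>" using ord_k p_gt_1 ord_eq_1[OF k] by auto
  ultimately have "z \<in> generate G {k}" using normal_iff generate.incl[of k "{k}" G] by blast
  then obtain i :: int where i: "z = k [^] i" using generate_singleton_mem_iff[OF k] by blast
  then have "\<not> int p dvd i" using z_ne_1 int_pow_eq_id[OF k] ord_k by simp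
  moreover have "k [^] i \<in> generate G {z}" unfolding i[symmetric] by (simp add: generate.incl)
  ultimately have "k \<in> generate G {z}"
    using prime_ord_coprime_pow[OF k prime_p ord_k _ normal_imp_subgroup[OF Z_normal]] by blast
  then obtain j :: int where "k = z [^] j" using generate_singleton_mem_iff[OF z] by blast
  then show False using not_commute commute_int_pow[of z g j] central[OF g] z g by simp
qed

text \<open>By \<open>normal_iff\<close> the normal subgroups are \<open>{\<one>}\<close> and the
  preimages of the subgroups of the quotient by \<open><z>\<close>, which is abelian of type
  \<open>(p^(m - 2), p)\<close>. The statement on \<open>g\<close> is a by-product used to find
  involutions in order 8.\<close>

lemma card_normal_subgroups: "card {N. N \<lhd> G} = (m - 2) * (p + 1) + 3" and two_le_m: "m \<ge> 2"
    and g_power: "g [^] (p ^ (m - 2)) \<in> generate G {z}"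
proof -
  let ?Z = "generate G {z}"
  interpret Z: normal ?Z G by (rule Z_normal)
  let ?Q = "G Mod ?Z"
  \<comment> \<open>Keeps the operations of the quotient folded, so that it is treated as an
    abstract group.\<close>
  note mult_FactGroup [simp del] one_FactGroup [simp del]
  interpret Q: group ?Q by (rule Z.factorgroup_is_group)
  define gq kq where "gq = ?Z #> g" and "kq = ?Z #> k"
  have gq: "gq \<in> carrier ?Q" and kq: "kq \<in> carrier ?Q"
    using g k by (auto simp: gq_def kq_def carrier_FactGroup)
  have commute: "gq \<otimes>\<^bsub>?Q\<^esub> kq = kq \<otimes>\<^bsub>?Q\<^esub> gq"
  proof -
    have "g \<otimes> k = g \<otimes> k \<otimes> inv g \<otimes> g" using g k by (simp add: m_assoc)
    also have "\<dots> = z \<otimes> (k \<otimes> g)" using conj_k central[OF k] g k z by (simp add: m_assoc)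
    finally have "?Z #> (g \<otimes> k) = ?Z #> (k \<otimes> g)"
      using coset_mult_assoc[OF Z.subset z, of "k \<otimes> g"] coset_join2[OF z Z.is_subgroup] g k
      by (simp add: generate.incl)
    then show ?thesis using g k by (simp add: gq_def kq_def Z.rcos_sum mult_FactGroup one_FactGroup)
  qed
  define e where "e a b = gq [^]\<^bsub>?Q\<^esub> (a::int) \<otimes>\<^bsub>?Q\<^esub> kq [^]\<^bsub>?Q\<^esub> (b::int)" for a b
  have e_car: "e a b \<in> carrier ?Q" for a b using gq kq by (simp add: e_def)
  have e_mult: "e a b \<otimes>\<^bsub>?Q\<^esub> e c d = e (a + c) (b + d)" for a b c d
  proof -
    have "kq [^]\<^bsub>?Q\<^esub> b \<otimes>\<^bsub>?Q\<^esub> gq [^]\<^bsub>?Q\<^esub> c = gq [^]\<^bsub>?Q\<^esub> c \<otimes>\<^bsub>?Q\<^esub> kq [^]\<^bsub>?Q\<^esub> b"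
      using Q.commute_int_pow_int_pow[OF commute gq kq] by simp
    then show ?thesis
      unfolding e_def Q.int_pow_mult[OF gq] Q.int_pow_mult[OF kq]
      using gq kq by (metis Q.int_pow_closed Q.m_assoc Q.m_closed)
  qed
  have e_0: "e 0 0 = \<one>\<^bsub>?Q\<^esub>" using gq kq by (simp add: e_def)
  have e_surj: "\<exists>a b. X = e a b" if X: "X \<in> carrier ?Q" for X
  proof -
    \<comment> \<open>The elements whose coset has the form \<open>e a b\<close> form a subgroup
      containing the generators \<open>g\<close> and \<open>k\<close>.\<close>
    let ?S = "{x \<in> carrier G. \<exists>a b. ?Z #> x = e a b}"
    have "subgroup ?S G"
    proof (rule subgroupI)
      have "?Z #> \<one> = e 0 0" using Z.subset e_0 by (simp add: one_FactGroup)
      then have "\<one> \<in> ?S" by blast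
      then show "?S \<noteq> {}" by blast
      show "inv x \<in> ?S" if "x \<in> ?S" for x
      proof -
        from that obtain a b where x: "x \<in> carrier G" "?Z #> x = e a b" by blast
        have "?Z #> inv x \<in> carrier ?Q" using x by (auto simp: carrier_FactGroup)
        moreover have "(?Z #> inv x) \<otimes>\<^bsub>?Q\<^esub> e a b = \<one>\<^bsub>?Q\<^esub>"
          using x Z.subset by (simp add: Z.rcos_sum mult_FactGroup one_FactGroup flip: x(2))
        moreover have "e (-a) (-b) \<otimes>\<^bsub>?Q\<^esub> e a b = \<one>\<^bsub>?Q\<^esub>" by (simp add: e_mult e_0)
        ultimately have "?Z #> inv x = e (-a) (-b)" using e_car by (metis Q.right_cancel)
        then show ?thesis using x by blast
      qed
      show "x \<otimes> y \<in> ?S" if "x \<in> ?S" "y \<in> ?S" for x y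
      proof -
        from that obtain a b c d where x: "x \<in> carrier G" "?Z #> x = e a b" "y \<in> carrier G" "?Z #> y = e c d" by blast
        then have "?Z #> (x \<otimes> y) = e (a + c) (b + d)" using Z.rcos_sum[of x y] e_mult[of a b c d] by (simp add: mult_FactGroup)
        then show ?thesis using x by blast
      qed
    qed auto
    moreover have "g \<in> ?S" "k \<in> ?S"
    proof -
      have "?Z #> g = e 1 0" "?Z #> k = e 0 1" using gq kq by (auto simp: e_def gq_def kq_def)
      then show "g \<in> ?S" "k \<in> ?S" using g k by blast+
    qed
    ultimately have "carrier G \<subseteq> ?S" using generate_subgroup_incl[of "{k, g}" ?S] generated by simp
    then show ?thesis using X by (auto simp: carrier_FactGroup)
  qed
  have ordQ: "order ?Q * p = p ^ m"
    using lagrange[OF Z.is_subgroup] order_G generate_pow_card[OF z] ord_z by (simp add: FactGroup_def order_def)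
  then obtain m' where "order ?Q = p ^ m'" using divides_primepow_nat[OF prime_p] by (metis dvd_triv_left)
  then obtain r where r: "Q.ord gq = p ^ r"
    using Q.ord_dvd_group_order[OF gq] divides_primepow_nat[OF prime_p] by metis
  have "?Z #> g [^] (p ^ r) = ?Z"
    using Q.pow_ord_eq_1[OF gq] Z.FactGroup_pow[OF g] r by (simp add: gq_def one_FactGroup)
  then have g_pow_r: "g [^] (p ^ r) \<in> ?Z" using coset_join1[OF _ _ Z.is_subgroup] g by simp
  have kq_p: "kq [^]\<^bsub>?Q\<^esub> (int p) = \<one>\<^bsub>?Q\<^esub>"
  proof -
    have "kq [^]\<^bsub>?Q\<^esub> (int p) = ?Z #> k [^] (int p)" unfolding kq_def using Z.FactGroup_int_pow[OF k] by simp
    also have "k [^] (int p) = \<one>" using int_pow_eq_id[OF k] ord_k by simp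
    finally show ?thesis using Z.subset by (simp add: one_FactGroup)
  qed
  have kq_pow: "kq [^]\<^bsub>?Q\<^esub> b = \<one>\<^bsub>?Q\<^esub>" if "int p dvd b" for b
    using kq_p that unfolding Q.int_pow_eq_id[OF kq] by (rule dvd_trans)
  have kernel: "e a b = \<one>\<^bsub>?Q\<^esub> \<longleftrightarrow> int p ^ r dvd a \<and> int p dvd b" for a b
  proof
    assume e1: "e a b = \<one>\<^bsub>?Q\<^esub>"
    \<comment> \<open>If \<open>g^a k^b\<close> is central, then \<open>k^b\<close> commutes with
      \<open>g\<close>; for \<open>b\<close> prime to \<open>p\<close> so would
      \<open>k\<close>.\<close>
    have pb: "int p dvd b"
    proof (rule ccontr)
      assume nb: "\<not> int p dvd b"
      let ?C = "{x \<in> carrier G. g \<otimes> x = x \<otimes> g}"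
      have sC: "subgroup ?C G" by (rule centralizer_subgroup[OF g])
      have "?Z #> (g [^] a \<otimes> k [^] b) = ?Z"
        using e1 g k Z.FactGroup_int_pow[OF g, of a] Z.FactGroup_int_pow[OF k, of b]
        by (simp add: e_def gq_def kq_def Z.rcos_sum mult_FactGroup one_FactGroup)
      then have "g [^] a \<otimes> k [^] b \<in> ?Z" using coset_join1[OF _ _ Z.is_subgroup] g k by simp
      then have "g [^] a \<otimes> k [^] b \<in> ?C"
        using generate_singleton_subset[OF sC, of z] central[OF g] z by auto
      moreover have "g [^] (-a) \<in> ?C" using commute_int_pow[of g g "-a"] g by simp
      ultimately have "g [^] (-a) \<otimes> (g [^] a \<otimes> k [^] b) \<in> ?C" using subgroup.m_closed[OF sC] by blast
      then have "k [^] b \<in> ?C" using g k by (simp add: int_pow_neg flip: m_assoc)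
      then have "k \<in> ?C" using prime_ord_coprime_pow[OF k prime_p ord_k nb sC] by blast
      then show False using not_commute by simp
    qed
    then have "kq [^]\<^bsub>?Q\<^esub> b = \<one>\<^bsub>?Q\<^esub>"
      using kq_pow pb by simp
    then have "gq [^]\<^bsub>?Q\<^esub> a = \<one>\<^bsub>?Q\<^esub>" using e1 gq by (simp add: e_def)
    then show "int p ^ r dvd a \<and> int p dvd b" using Q.int_pow_eq_id[OF gq] r pb by simp
  next
    assume a: "int p ^ r dvd a \<and> int p dvd b"
    then have "gq [^]\<^bsub>?Q\<^esub> a = \<one>\<^bsub>?Q\<^esub>" using Q.int_pow_eq_id[OF gq] r by simp
    moreover have "kq [^]\<^bsub>?Q\<^esub> b = \<one>\<^bsub>?Q\<^esub>" using a kq_pow by simp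
    ultimately show "e a b = \<one>\<^bsub>?Q\<^esub>" by (simp add: e_def)
  qed
  have e_eq: "e a b = e c d \<longleftrightarrow> int p ^ r dvd a - c \<and> int p dvd b - d" for a b c d
  proof -
    have "e a b = e (a - c) (b - d) \<otimes>\<^bsub>?Q\<^esub> e c d" by (simp add: e_mult)
    then have "e a b = e c d \<longleftrightarrow> e (a - c) (b - d) = \<one>\<^bsub>?Q\<^esub>"
      using e_car by (metis Q.l_cancel_one' Q.r_cancel_one')
    then show ?thesis by (simp add: kernel)
  qed
  have cardQ: "card (subgroups ?Q) = r * (p + 1) + 2"
  proof (rule card_subgroups_rank_two[OF Q.is_group prime_p _ e_mult e_eq])
    show "carrier ?Q = {e a b |a b. True}" using e_surj e_car by blast
  qed
  have "bij_betw (\<lambda>(a, b). e a b) ({0..<int p ^ r} \<times> {0..<int p}) (carrier ?Q)"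
  proof (rule bij_betwI')
    fix x y assume "x \<in> {0..<int p ^ r} \<times> {0..<int p}" "y \<in> {0..<int p ^ r} \<times> {0..<int p}"
    then show "((\<lambda>(a, b). e a b) x = (\<lambda>(a, b). e a b) y) = (x = y)"
      by (auto simp: e_eq simp flip: mod_eq_dvd_iff)
  next
    fix X assume "X \<in> carrier ?Q"
    then obtain a b where X: "X = e a b" using e_surj by blast
    have "X = e (a mod int p ^ r) (b mod int p)" unfolding X e_eq by simp
    then show "\<exists>x\<in>{0..<int p ^ r} \<times> {0..<int p}. X = (\<lambda>(a, b). e a b) x"
      using p_gt_1 by (intro bexI[of _ "(a mod int p ^ r, b mod int p)"]) auto
  qed (auto simp: e_car)
  then have "card (carrier ?Q) = card ({0..<int p ^ r} \<times> {0..<int p})" by (simp add: bij_betw_same_card)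
  then have "order ?Q = p ^ r * p" by (simp add: order_def card_cartesian_product nat_power_eq)
  \<comment> \<open>The exponent \<open>r\<close>, so far known only through the order of
    \<open>gq\<close>, is determined by counting: one factor \<open>p\<close> comes from
    \<open>kq\<close>, one from \<open><z>\<close>.\<close>
  then have "p ^ (r + 2) = p ^ m" using ordQ by (simp add: power_add power2_eq_square mult_ac)
  then have m: "m = r + 2" using p_gt_1 by (metis power_inject_exp)
  \<comment> \<open>The trivial group is the one normal subgroup not above \<open><z>\<close>, which
    turns the 2 of the rank-two count into 3.\<close>
  have "{N. N \<lhd> G} = {A. subgroup A G \<and> ?Z \<subseteq> A} \<union> {{\<one>}}"
    using normal_iff Z_subset_iff by auto
  moreover have "{\<one>} \<notin> {A. subgroup A G \<and> ?Z \<subseteq> A}" using Z_subset_iff z_ne_1 by auto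
  moreover have "card {A. subgroup A G \<and> ?Z \<subseteq> A} = r * (p + 1) + 2"
    using bij_betw_same_card[OF Z.bij_betw_subgroups_Mod] cardQ by simp
  moreover have "finite {A. subgroup A G \<and> ?Z \<subseteq> A}"
    using finite_subgroups[OF fin] by (rule finite_subset[rotated]) (auto simp: subgroups_def)
  ultimately have "card {N. N \<lhd> G} = r * (p + 1) + 3" by (simp add: card_insert_if)
  then show "card {N. N \<lhd> G} = (m - 2) * (p + 1) + 3" "m \<ge> 2" "g [^] (p ^ (m - 2)) \<in> ?Z" using m g_pow_r by auto
qed

text \<open>Either \<open>g\<close> or \<open>g k\<close> is an involution outside the centraliser of \<open>k\<close>, which is normal.\<close>

lemma two_nonnormal_classes:
  assumes p2: "p = 2" and m3: "m = 3"
  shows "card (conj_class G ` nonnormal_subgroups G) \<ge> 2"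
proof -
  let ?C = "{x \<in> carrier G. k \<otimes> x = x \<otimes> k}"
  have sC: "subgroup ?C G" by (rule centralizer_subgroup[OF k])
  have zC: "z \<in> ?C" using central[OF k] z by simp
  have C: "?C \<lhd> G" by (rule normal_if_z_mem[OF sC zC])
  have k2: "k \<otimes> k = \<one>" and z2: "z \<otimes> z = \<one>"
    using pow_eq_id[OF k, of 2] pow_eq_id[OF z, of 2] ord_k ord_z p2 k z by (auto simp: numeral_2_eq_2)
  have kg: "g \<otimes> k = z \<otimes> (k \<otimes> g)"
  proof -
    have "g \<otimes> k = g \<otimes> k \<otimes> inv g \<otimes> g" using g k by (simp add: m_assoc)
    then show ?thesis using conj_k central[OF k] g k z by (simp add: m_assoc)
  qed
  \<comment> \<open>Here \<open>p^(m - 2) = 2\<close>, so \<open>g_power\<close> puts the square of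
    \<open>g\<close> into \<open><z> = {\<one>, z}\<close>.\<close>
  have gg: "g \<otimes> g = \<one> \<or> g \<otimes> g = z"
  proof -
    obtain i :: int where "g [^] (2::nat) = z [^] i"
      using g_power generate_singleton_mem_iff[OF z] by (auto simp: p2 m3)
    moreover have "z [^] i = \<one> \<or> z [^] i = z"
    proof (cases "even i")
      case True
      then show ?thesis using int_pow_eq_id[OF z] ord_z p2 by simp
    next
      case False
      then have "z [^] i = z [^] (1::int)" using int_pow_eq[OF z, of i 1] ord_z p2 by simp
      then show ?thesis using z by simp
    qed
    ultimately show ?thesis using g by (simp add: numeral_2_eq_2)
  qed
  obtain w where w: "w \<in> carrier G" "w \<otimes> w = \<one>" "w \<notin> ?C"
  proof (cases "g \<otimes> g = \<one>")
    case True
    then show ?thesis using that[of g] g not_commute by auto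
  next
    case False
    \<comment> \<open>If \<open>g\<close> squares to \<open>z\<close>, the commutator contributes a
      second \<open>z\<close> and the two cancel.\<close>
    have "(g \<otimes> k) \<otimes> (g \<otimes> k) = z \<otimes> (k \<otimes> g) \<otimes> (g \<otimes> k)" using kg by simp
    also have "\<dots> = z \<otimes> (k \<otimes> (g \<otimes> g) \<otimes> k)" using g k z by (simp add: m_assoc)
    also have "\<dots> = z \<otimes> (z \<otimes> (k \<otimes> k))" using False gg central[OF k] k z by (simp add: m_assoc)
    also have "\<dots> = \<one>" using k2 z2 k z by (simp flip: m_assoc)
    finally have "(g \<otimes> k) \<otimes> (g \<otimes> k) = \<one>" .
    moreover have "k \<otimes> (g \<otimes> k) \<noteq> (g \<otimes> k) \<otimes> k" using not_commute g k by (simp flip: m_assoc)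
    ultimately show ?thesis using that[of "g \<otimes> k"] g k by auto
  qed
  have w1: "w \<noteq> \<one>" using w(3) k by auto
  let ?K = "generate G {k}"
  have "inv w = w" using w by (metis inv_equality)
  have W: "subgroup {\<one>, w} G"
    by (rule subgroupI) (use w \<open>inv w = w\<close> in auto)
  have sK: "subgroup ?K G" using k by (intro generate_is_subgroup) auto
  have KC: "?K \<subseteq> ?C" using generate_singleton_subset[OF sC] k by simp
  have WN: "{\<one>, w} \<in> nonnormal_subgroups G"
    using W normal_iff[of "{\<one>, w}"] w1 z_ne_1 zC w(3) by (auto simp: nonnormal_subgroups_def)
  have nK: "\<not> ?K \<lhd> G" by (rule k_nonnormal)
  then have KN: "?K \<in> nonnormal_subgroups G" using sK by (simp add: nonnormal_subgroups_def)
  \<comment> \<open>All conjugates of \<open>?K\<close> stay in the normal subgroup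
    \<open>?C\<close>, which \<open>w\<close> avoids; this separates the two classes.\<close>
  have "A \<subseteq> ?C" if "A \<in> conj_class G ?K" for A
  proof
    fix x assume "x \<in> A"
    then obtain y h where "y \<in> carrier G" "h \<in> ?K" "x = y \<otimes> h \<otimes> inv y"
      using \<open>A \<in> conj_class G ?K\<close> mem_conj[OF subgroup.subset[OF sK]] by (auto simp: orbit_def)
    then show "x \<in> ?C" using normal.inv_op_closed2[OF C] KC by blast
  qed
  then have "{\<one>, w} \<notin> conj_class G ?K" using w(3) by blast
  then have "conj_class G {\<one>, w} \<noteq> conj_class G ?K" using conj_class_self[OF W] by metis
  moreover have "{conj_class G {\<one>, w}, conj_class G ?K} \<subseteq> conj_class G ` nonnormal_subgroups G"
    using WN KN by blast
  moreover have "finite (conj_class G ` nonnormal_subgroups G)"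
    using finite_subgroups[OF fin] by (auto simp: subgroups_def nonnormal_subgroups_def intro!: finite_imageI elim!: finite_subset[rotated])
  ultimately have "card {conj_class G {\<one>, w}, conj_class G ?K} \<le> card (conj_class G ` nonnormal_subgroups G)"
    by (intro card_mono)
  then show ?thesis using \<open>conj_class G {\<one>, w} \<noteq> conj_class G ?K\<close> by simp
qed

lemma d_prime_eq:
  defines "N \<equiv> (real m - 2) * (real p + 1) + 3"
  shows "d_prime G = (N + card (conj_class G ` nonnormal_subgroups G)) / (N + card (nonnormal_subgroups G))"
proof -
  have "real (card {N. N \<lhd> G}) = N"
    using two_le_m unfolding card_normal_subgroups N_def of_nat_add of_nat_mult by (simp add: of_nat_diff)
  then show ?thesis using card_normal_nonnormal[OF fin] by (simp add: d_prime_def)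
qed

end

section \<open>Numerical bounds for minimal sections\<close>

lemma (in minimal_non_dedekind_p_group) nonnormal_classes:
  shows "card (conj_class G ` nonnormal_subgroups G) \<ge> 1"
    and "p * card (conj_class G ` nonnormal_subgroups G) \<le> card (nonnormal_subgroups G)"
proof -
  have "finite (nonnormal_subgroups G)"
    using finite_subgroups[OF fin] by (rule finite_subset[rotated]) (auto simp: subgroups_def nonnormal_subgroups_def)
  then show "card (conj_class G ` nonnormal_subgroups G) \<ge> 1"
    using ex_nonnormal by (simp add: Suc_le_eq card_gt_0_iff)
  show "p * card (conj_class G ` nonnormal_subgroups G) \<le> card (nonnormal_subgroups G)"
    by (rule p_group_nonnormal_classes[OF prime_p order_G])
qed

text \<open>Once \<open>\<nu>\<close> is lowered to \<open>p c\<close>, cross-multiplication leaves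
  the difference \<open>N (p - 1) (c - 1)\<close>.\<close>

lemma ratio_le:
  fixes N c \<nu> p :: real
  assumes "N \<ge> 0" "c \<ge> 1" "p \<ge> 1" "p * c \<le> \<nu>"
  shows "(N + c) / (N + \<nu>) \<le> (N + 1) / (N + p)"
proof -
  have "p * c > 0" using assms by simp
  then have pos: "N + p * c > 0" "N + \<nu> > 0" "N + p > 0" using assms by linarith+
  have "(N + c) / (N + \<nu>) \<le> (N + c) / (N + p * c)"
    using assms pos by (intro divide_left_mono mult_pos_pos) auto
  also have "\<dots> \<le> (N + 1) / (N + p)"
  proof -
    have "N * ((p - 1) * (c - 1)) \<ge> 0" using assms by simp
    then have "(N + c) * (N + p) \<le> (N + 1) * (N + p * c)" by (simp add: algebra_simps)
    then show ?thesis using pos by (simp add: pos_divide_le_eq pos_le_divide_eq)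
  qed
  finally show ?thesis .
qed

text \<open>The bound is \<open>(N + 1) / (N + p)\<close> at \<open>N = (n - 2)(p + 1) + 3\<close>;
  it grows with \<open>N\<close> because it equals \<open>1 - (p - 1) / (N + p)\<close>.\<close>

lemma (in minimal_non_dedekind_p_group) d_prime_le:
  assumes "m \<le> n"
  shows "d_prime G \<le> ((real n - 2) * (real p + 1) + 4) / ((real n - 1) * (real p + 1) + 2)"
proof -
  define N where "N m = (real m - 2) * (real p + 1) + 3" for m
  have p1: "real p > 1" using p_gt_1 by simp
  have N_pos: "N m > 0" using two_le_m by (simp add: N_def add_nonneg_pos)
  have N_mono: "N m \<le> N n" using assms by (simp add: N_def mult_right_mono)
  have "real p * real (card (conj_class G ` nonnormal_subgroups G)) \<le> real (card (nonnormal_subgroups G))"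
    using of_nat_mono[OF nonnormal_classes(2), where 'a = real] by simp
  then have "d_prime G \<le> (N m + 1) / (N m + real p)"
    unfolding d_prime_eq N_def[symmetric] using nonnormal_classes(1) N_pos p1
    by (intro ratio_le) auto
  also have "\<dots> \<le> (N n + 1) / (N n + real p)"
  proof -
    have "(N n - N m) * (real p - 1) \<ge> 0" using N_mono p1 by simp
    then show ?thesis using N_pos N_mono p1 by (simp add: field_simps)
  qed
  also have "\<dots> = ((real n - 2) * (real p + 1) + 4) / ((real n - 1) * (real p + 1) + 2)"
    by (simp add: N_def algebra_simps)
  finally show ?thesis .
qed

text \<open>The general bound gives only 7/8 for \<open>m = 3\<close>. There \<open>N = 6\<close>,
  and \<open>(6 + c) / (6 + 2 c)\<close> drops to 4/5 exactly from \<open>c = 2\<close> on. For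
  \<open>m = 2\<close> one has \<open>N = 3\<close>, and a single class already yields 4/5.\<close>

lemma (in minimal_non_dedekind_p_group) d_prime_le_order_8:
  assumes "p = 2" "m \<le> 3"
  shows "d_prime G \<le> 4 / 5"
proof -
  let ?c = "real (card (conj_class G ` nonnormal_subgroups G))"
  let ?v = "real (card (nonnormal_subgroups G))"
  have v: "2 * ?c \<le> ?v" using of_nat_mono[OF nonnormal_classes(2), where 'a = real] assms by simp
  have c: "?c \<ge> 1" using nonnormal_classes(1) by simp
  consider "m = 2" | "m = 3" using two_le_m assms by linarith
  then show ?thesis
  proof cases
    case 1
    have "(3 + ?c) / (3 + ?v) \<le> 4 / 5" using v c by (simp add: divide_simps)
    then show ?thesis unfolding d_prime_eq by (simp add: 1 assms)
  next
    case 2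
    have "?c \<ge> 2" using two_nonnormal_classes[OF assms(1) 2] by simp
    then have "(6 + ?c) / (6 + ?v) \<le> 4 / 5" using v by (simp add: divide_simps)
    then show ?thesis unfolding d_prime_eq by (simp add: 2 assms)
  qed
qed

subsection \<open>The modular \<open>p\<close>-group\<close>

text \<open>\<open>independent\<close> says that the normal form \<open>x^i y^j\<close> is unique;
  it is the one property that does not follow from the relations and must be supplied by a
  model.\<close>

locale modular_p_group = group +
  fixes p n :: nat and x y
  assumes prime_p: "prime p" and n3: "n \<ge> 3"
    and x [simp]: "x \<in> carrier G" and y [simp]: "y \<in> carrier G"
    and x_pow: "x [^] (p ^ (n - 1)) = \<one>" and y_pow: "y [^] p = \<one>"
    and rel: "y \<otimes> x = x [^] (p ^ (n - 2) + 1) \<otimes> y"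
    and generated: "generate G {x, y} = carrier G"
    and independent: "\<And>i j. x [^] (i::int) \<otimes> y [^] (j::int) = \<one> \<Longrightarrow> int p ^ (n - 1) dvd i \<and> int p dvd j"
begin

definition "P = int p"
text \<open>The element \<open>x^q = e q 0\<close> is central of order \<open>p\<close> and plays
  the role of \<open>z\<close>.\<close>

definition "q = P ^ (n - 2)"
definition "e i j = x [^] (i::int) \<otimes> y [^] (j::int)"

lemma P_prime: "prime P" and P_gt_1: "P > 1"
  using prime_p prime_gt_1_nat[OF prime_p] by (auto simp: P_def)

lemma Pq: "P ^ (n - 1) = P * q"
proof -
  have "n - 1 = Suc (n - 2)" using n3 by simp
  then show ?thesis by (simp add: q_def)
qed

lemma q_pos: "q > 0"
  using P_gt_1 by (simp add: q_def)

lemma P_dvd_q: "P dvd q"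
  using n3 by (simp add: q_def)

text \<open>Products of two factors \<open>q\<close> vanish in exponents of \<open>x\<close>, so
  \<open>(1 + q)^j\<close> acts as \<open>1 + q j\<close>. This keeps all formulas below linear in
  \<open>q\<close>.\<close>

lemma Pq_dvd_qq: "P * q dvd q * q"
  using P_dvd_q by simp

lemma e_closed [simp]: "e i j \<in> carrier G"
  by (simp add: e_def)

lemma x_pow_eq: "x [^] (i::int) = x [^] (j::int)" if "P * q dvd i - j"
proof -
  have "x [^] (P * q) = \<one>"
    using x_pow unfolding Pq[symmetric] by (simp add: P_def int_pow_int flip: of_nat_power)
  then have "int (ord x) dvd P * q" by (simp add: int_pow_eq_id)
  then show ?thesis unfolding int_pow_eq[OF x] using that by (metis dvd_trans dvd_diff_commute)
qed

lemma y_pow_eq: "y [^] (i::int) = y [^] (j::int)" if "P dvd i - j"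
proof -
  have "y [^] P = \<one>" using y_pow by (simp add: P_def int_pow_int)
  then have "int (ord y) dvd P" by (simp add: int_pow_eq_id)
  then show ?thesis unfolding int_pow_eq[OF y] using that by (metis dvd_trans dvd_diff_commute)
qed

text \<open>Conjugating \<open>y\<close> by \<open>x^(-i)\<close> gives \<open>?z^i y\<close> with
  commuting factors, which can be raised to any integer power \<open>j\<close>, negative ones
  included.\<close>

lemma y_x_commute: "y [^] (j::int) \<otimes> x [^] (i::int) = x [^] (i + q * j * i) \<otimes> y [^] j"
proof -
  let ?z = "x [^] q"
  have yx: "y \<otimes> x \<otimes> inv y = x [^] (1 + q)"
  proof -
    have "x [^] (p ^ (n - 2) + 1) = x [^] (1 + q)"
      by (simp add: q_def P_def add.commute flip: int_pow_int)
    then show ?thesis using rel by (simp add: m_assoc)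
  qed
  have yxi: "y \<otimes> x [^] i \<otimes> inv y = x [^] ((1 + q) * i)" for i :: int
    using conj_int_pow[OF y x, of i] yx by (simp add: int_pow_pow)
  have yz: "y \<otimes> ?z = ?z \<otimes> y"
  proof -
    have "y \<otimes> ?z \<otimes> inv y = ?z"
      unfolding yxi by (rule x_pow_eq) (use Pq_dvd_qq in \<open>simp add: algebra_simps\<close>)
    then show ?thesis by (metis inv_solve_right' int_pow_closed m_closed x y)
  qed
  have xy: "x [^] (-i) \<otimes> y \<otimes> inv (x [^] (-i)) = ?z [^] i \<otimes> y"
  proof -
    have "y \<otimes> x [^] i = x [^] ((1 + q) * i) \<otimes> y"
      using yxi[of i] by (metis inv_solve_right' int_pow_closed m_closed x y)
    then have "x [^] (-i) \<otimes> (y \<otimes> x [^] i) = x [^] (-i + (1 + q) * i) \<otimes> y"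
      unfolding int_pow_mult[OF x, of "-i"] by (simp add: m_assoc)
    then show ?thesis by (simp add: int_pow_neg int_pow_pow m_assoc algebra_simps)
  qed
  have "?z [^] i \<otimes> y = y \<otimes> ?z [^] i" using commute_int_pow[OF yz[symmetric]] by simp
  then have "(?z [^] i \<otimes> y) [^] j = (?z [^] i) [^] j \<otimes> y [^] j"
    by (intro int_pow_mult_distrib) auto
  then have "x [^] (-i) \<otimes> y [^] j \<otimes> inv (x [^] (-i)) = x [^] (q * i * j) \<otimes> y [^] j"
    using conj_int_pow[of "x [^] (-i)" y j] xy by (simp add: int_pow_pow mult.assoc)
  then have "x [^] (-i) \<otimes> (y [^] j \<otimes> x [^] i) = x [^] (q * i * j) \<otimes> y [^] j"
    by (simp add: int_pow_neg m_assoc)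
  then have "x [^] i \<otimes> (x [^] (-i) \<otimes> (y [^] j \<otimes> x [^] i)) = x [^] i \<otimes> (x [^] (q * i * j) \<otimes> y [^] j)"
    by simp
  then show ?thesis
    by (simp add: int_pow_mult mult_ac flip: m_assoc) (simp add: int_pow_neg)
qed

lemma e_mult: "e i j \<otimes> e k l = e (i + k + q * j * k) (j + l)"
proof -
  have "e i j \<otimes> e k l = x [^] i \<otimes> (y [^] j \<otimes> x [^] k) \<otimes> y [^] l" by (simp add: e_def m_assoc)
  also have "\<dots> = x [^] i \<otimes> (x [^] (k + q * j * k) \<otimes> y [^] j) \<otimes> y [^] l" by (simp add: y_x_commute)
  also have "\<dots> = e (i + (k + q * j * k)) (j + l)"
    unfolding e_def int_pow_mult[OF x, of i] int_pow_mult[OF y, of j] by (simp add: m_assoc)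
  finally show ?thesis by (simp add: add.assoc)
qed

lemma e_0: "e 0 0 = \<one>"
  by (simp add: e_def)

lemma e_10: "e 1 0 = x" and e_01: "e 0 1 = y"
  by (simp_all add: e_def)

lemma inv_e: "inv (e i j) = e (- i + q * j * i) (- j)"
proof -
  have "inv (e i j) = e 0 (-j) \<otimes> e (-i) 0" by (simp add: e_def inv_mult_group int_pow_neg)
  then show ?thesis by (simp add: e_mult)
qed

lemma e_eqI: "\<lbrakk>P * q dvd i - k; P dvd j - l\<rbrakk> \<Longrightarrow> e i j = e k l"
  unfolding e_def using x_pow_eq y_pow_eq by simp

lemma e_eq: "e i j = e k l \<longleftrightarrow> P * q dvd i - k \<and> P dvd j - l"
proof
  assume eq: "e i j = e k l"
  have "e (i - k) (j - l) = e (-k) 0 \<otimes> e i j \<otimes> e 0 (-l)" by (simp add: e_mult)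
  also have "\<dots> = \<one>" unfolding eq by (simp add: e_mult e_0)
  finally show "P * q dvd i - k \<and> P dvd j - l"
    using independent[of "i - k" "j - l"] unfolding e_def P_def[symmetric] Pq by blast
qed (auto intro: e_eqI)

lemma e_surj: "a \<in> carrier G \<Longrightarrow> \<exists>i j. a = e i j"
proof -
  assume a: "a \<in> carrier G"
  have "subgroup {e i j | i j. True} G"
  proof (rule subgroupI)
    show "inv a \<in> {e i j | i j. True}" if "a \<in> {e i j | i j. True}" for a using that inv_e by auto
    show "a \<otimes> b \<in> {e i j | i j. True}" if "a \<in> {e i j | i j. True}" "b \<in> {e i j | i j. True}" for a b
    proof -
      from that obtain i j k l where "a = e i j" "b = e k l" by blast
      then have "a \<otimes> b = e (i + k + q * j * k) (j + l)" by (simp add: e_mult)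
      then show ?thesis by blast
    qed
  qed auto
  moreover have "{x, y} \<subseteq> {e i j | i j. True}"
    using e_10 e_01 by (metis (mono_tags, lifting) empty_subsetI insert_subset mem_Collect_eq)
  ultimately have "generate G {x, y} \<subseteq> {e i j | i j. True}" by (rule generate_subgroup_incl[rotated])
  then show ?thesis using generated a by auto
qed

lemma order_eq: "order G = p ^ n"
proof -
  have "bij_betw (\<lambda>(a, b). e a b) ({0..<P * q} \<times> {0..<P}) (carrier G)"
  proof (rule bij_betwI')
    fix s t assume "s \<in> {0..<P * q} \<times> {0..<P}" "t \<in> {0..<P * q} \<times> {0..<P}"
    then show "((\<lambda>(a, b). e a b) s = (\<lambda>(a, b). e a b) t) = (s = t)"
      by (auto simp: e_eq simp flip: mod_eq_dvd_iff)
  next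
    fix a assume "a \<in> carrier G"
    then obtain i j where a: "a = e i j" using e_surj by blast
    have "a = e (i mod (P * q)) (j mod P)" unfolding a e_eq by simp
    then show "\<exists>s\<in>{0..<P * q} \<times> {0..<P}. a = (\<lambda>(a, b). e a b) s"
      using P_gt_1 q_pos by (intro bexI[of _ "(i mod (P * q), j mod P)"]) auto
  qed auto
  then have "card (carrier G) = card ({0..<P * q} \<times> {0..<P})" by (simp add: bij_betw_same_card)
  also have "\<dots> = nat (P ^ (n - 1) * P)"
    unfolding Pq using P_gt_1 q_pos by (simp add: nat_mult_distrib)
  also have "P ^ (n - 1) * P = P ^ n" using n3 by (metis One_nat_def Suc_pred less_le_trans power_Suc2 zero_less_numeral)
  finally show ?thesis by (simp add: order_def P_def nat_power_eq)
qed

lemma finite_carrier: "finite (carrier G)"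
  using order_eq prime_gt_0_nat[OF prime_p] by (simp flip: order_gt_0_iff_finite)

text \<open>Commutators lie in \<open><x^q>\<close> and are bilinear in the exponents, hence the
  determinant \<open>j k - i l\<close>.\<close>

lemma conj_e: "e i j \<otimes> e k l \<otimes> inv (e i j) = e (k + q * (j * k - i * l)) l"
proof -
  have "e (k + q * (j * k - i * l)) l \<otimes> e i j = e (i + k + q * j * k) (j + l)"
    unfolding e_mult by (rule e_eqI) (simp_all add: algebra_simps)
  then show ?thesis by (simp add: e_mult inv_solve_right')
qed

text \<open>The \<open>t\<close>-th multiplication adds \<open>q i j t\<close> to the exponent of
  \<open>x\<close>; \<open>s (s - 1) / 2\<close> is the sum of the \<open>t < s\<close>.\<close>

lemma e_pow: "e i j [^] (s::nat) = e (int s * i + q * i * j * int (s * (s - 1) div 2)) (int s * j)"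
proof (induction s)
  case 0
  then show ?case by (simp add: e_0)
next
  case (Suc s)
  have "Suc s * (Suc s - 1) div 2 = s * (s - 1) div 2 + s"
    by (cases s) (auto simp: algebra_simps)
  then show ?case by (simp add: Suc.IH e_mult algebra_simps)
qed

section \<open>Subgroups of the modular group in normal-form coordinates\<close>

lemma e_int_pow_snd: "\<exists>c. e i j [^] (s::int) = e c (s * j)"
proof (cases s rule: int_cases2)
  case (nonneg m)
  then show ?thesis by (auto simp: int_pow_int e_pow)
next
  case (nonpos m)
  then show ?thesis by (auto simp: int_pow_neg int_pow_int e_pow inv_e)
qed

text \<open>The group \<open><x>\<close> is cyclic of order \<open>p^(n - 1)\<close>. The gcd of
  \<open>c\<close> with this order is a smaller power of \<open>p\<close>, so it divides
  \<open>q\<close>, and Bezout writes \<open>x^q\<close> as a power of \<open>x^c\<close>.\<close>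

lemma z_mem_of_x_pow:
  assumes A: "subgroup A G" and "e c 0 \<in> A" "e c 0 \<noteq> \<one>"
  shows "e q 0 \<in> A"
proof -
  have nd: "\<not> P ^ (n - 1) dvd c" unfolding Pq using assms(3) e_eq[of c 0 0 0] by (auto simp: e_0)
  have "gcd c (P ^ (n - 1)) dvd P ^ (n - 1)" by simp
  then obtain k where k: "k \<le> n - 1" "gcd c (P ^ (n - 1)) = P ^ k"
    using divides_primepow[OF P_prime, of "gcd c (P ^ (n - 1))" "n - 1"] by auto
  have "k \<noteq> n - 1" using nd k(2) by (metis gcd_dvd1)
  then have "P ^ k dvd q" using k(1) unfolding q_def by (intro le_imp_power_dvd) simp
  then obtain t where t: "q = P ^ k * t" by (auto elim: dvdE)
  obtain u v where uv: "u * c + v * P ^ (n - 1) = P ^ k"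
    using bezout_int[of c "P ^ (n - 1)"] k by auto
  have "e c 0 [^] (u * t) \<in> A" by (rule subgroup_int_pow_closed[OF A assms(2)])
  also have "e c 0 [^] (u * t) = e (c * (u * t)) 0" by (simp add: e_def int_pow_pow)
  also have "\<dots> = e q 0"
  proof (rule e_eqI)
    have "P ^ k - u * c = v * (P * q)" using uv unfolding Pq by simp
    moreover have "q - c * (u * t) = (P ^ k - u * c) * t" using t by (simp add: algebra_simps)
    ultimately have "q - c * (u * t) = P * q * (v * t)" by (simp add: mult_ac)
    then show "P * q dvd c * (u * t) - q" by (metis dvd_diff_commute dvd_triv_left)
  qed simp
  finally show ?thesis .
qed

lemma snd_coprime_pow:
  assumes A: "subgroup A G" and "e i j \<in> A" "\<not> P dvd j"
  obtains c where "e c 1 \<in> A"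
proof -
  have "coprime j P" using prime_imp_coprime[OF P_prime assms(3)] by (simp add: coprime_commute)
  then obtain u v where uv: "u * j + v * P = 1"
    using bezout_int[of j P] by (metis coprime_imp_gcd_eq_1)
  obtain c where c: "e i j [^] u = e c (u * j)" using e_int_pow_snd by blast
  have "e c (u * j) = e c 1"
  proof (rule e_eqI)
    have "u * j - 1 = P * (-v)" using uv by (simp add: algebra_simps)
    then show "P dvd u * j - 1" by simp
  qed simp
  then have "e c 1 \<in> A" using subgroup_int_pow_closed[OF A assms(2), of u] c by simp
  then show ?thesis by (rule that)
qed

text \<open>Dividing \<open>t\<close> by the power of \<open>e i 1\<close> with the same second
  exponent leaves a power of \<open>x\<close> in \<open>A\<close>.\<close>

lemma subgroup_decompose:
  assumes A: "subgroup A G" and w: "e i 1 \<in> A" and t: "t \<in> A"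
  obtains c b where "t = e c 0 \<otimes> e i 1 [^] (b::int)" "e c 0 \<in> A"
proof -
  obtain a b where ab: "t = e a b" using e_surj subgroup.mem_carrier[OF A t] by blast
  obtain d where d: "e i 1 [^] (-b) = e d (-b * 1)" using e_int_pow_snd by blast
  have mem: "t \<otimes> e i 1 [^] (-b) \<in> A"
    using subgroup.m_closed[OF A t] subgroup_int_pow_closed[OF A w] by blast
  have "t \<otimes> e i 1 [^] (-b) = e (a + d + q * b * d) 0" unfolding ab d e_mult by simp
  moreover have "t = (t \<otimes> e i 1 [^] (-b)) \<otimes> e i 1 [^] b"
    by (simp add: ab m_assoc flip: int_pow_mult)
  ultimately show ?thesis using that mem by metis
qed

lemma normal_if_z_mem:
  assumes A: "subgroup A G" and z: "e q 0 \<in> A"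
  shows "A \<lhd> G"
proof (rule normal_invI[OF A])
  fix g h assume g: "g \<in> carrier G" and h: "h \<in> A"
  obtain i j where gij: "g = e i j" using e_surj g by blast
  obtain k l where hkl: "h = e k l" using e_surj subgroup.mem_carrier[OF A h] by blast
  have "g \<otimes> h \<otimes> inv g = e q 0 [^] (j * k - i * l) \<otimes> h"
    unfolding gij hkl conj_e by (simp add: e_def int_pow_pow int_pow_mult m_assoc) (simp add: m_assoc[symmetric] flip: int_pow_mult, simp add: add.commute)
  then show "g \<otimes> h \<otimes> inv g \<in> A" using subgroup.m_closed[OF A subgroup_int_pow_closed[OF A z] h] by simp
qed

text \<open>An element of \<open>N\<close> either is a power of \<open>x\<close>, or its commutator
  with \<open>x\<close> is a nontrivial power of \<open>x^q\<close>; both cases reduce to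
  \<open>z_mem_of_x_pow\<close>.\<close>

lemma z_mem_if_normal:
  assumes N: "N \<lhd> G" and "N \<noteq> {\<one>}"
  shows "e q 0 \<in> N"
proof -
  have sN: "subgroup N G" using N by (rule normal_imp_subgroup)
  obtain a where a: "a \<in> N" "a \<noteq> \<one>" using assms subgroup.one_closed[OF sN] by blast
  obtain i j where ij: "a = e i j" using e_surj subgroup.mem_carrier[OF sN a(1)] by blast
  show ?thesis
  proof (cases "P dvd j")
    case True
    then have "a = e i 0" unfolding ij by (intro e_eqI) auto
    then show ?thesis using z_mem_of_x_pow[OF sN] a by simp
  next
    case False
    have "e 1 0 \<otimes> a \<otimes> inv (e 1 0) \<otimes> inv a \<in> N"
      using subgroup.m_closed[OF sN normal.inv_op_closed2[OF N _ a(1)] subgroup.m_inv_closed[OF sN a(1)]] by simp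
    also have "e 1 0 \<otimes> a \<otimes> inv (e 1 0) = e (- (q * j)) 0 \<otimes> a"
      unfolding ij conj_e by (simp add: e_mult)
    also have "\<dots> \<otimes> inv a = e (- (q * j)) 0" by (simp add: ij m_assoc)
    finally have mem: "e (- (q * j)) 0 \<in> N" .
    moreover have "e (- (q * j)) 0 \<noteq> \<one>"
      using False q_pos e_eq[of "- (q * j)" 0 0 0] by (simp add: e_0 mult.commute)
    ultimately show ?thesis using z_mem_of_x_pow[OF sN] by blast
  qed
qed

text \<open>If \<open>T\<close> is not inside \<open><x>\<close>, it contains some
  \<open>w = x^i y\<close>. A power \<open>x^c\<close> in \<open>T\<close> with \<open>c\<close>
  prime to \<open>p\<close> would yield \<open>x\<close>, then \<open>y\<close>, then everything. So
  the powers of \<open>x\<close> in \<open>T\<close> lie in the central \<open><x^p>\<close>, and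
  together with \<open>w\<close> they generate \<open>T\<close>.\<close>

lemma commutative_proper:
  assumes T: "subgroup T G" "T \<noteq> carrier G" and "s \<in> T" "t \<in> T"
  shows "s \<otimes> t = t \<otimes> s"
proof (cases "\<exists>i j. e i j \<in> T \<and> \<not> P dvd j")
  case False
  obtain i j k l where "s = e i j" "t = e k l"
    using e_surj subgroup.mem_carrier[OF T(1)] assms(3,4) by metis
  then have "s = e i 0" "t = e k 0" using False assms(3,4) by (auto intro!: e_eqI)
  then show ?thesis by (simp add: e_mult add.commute)
next
  case True
  then obtain i where w: "e i 1 \<in> T" using snd_coprime_pow[OF T(1)] by blast
  have P_dvd: "P dvd c" if c: "e c 0 \<in> T" for c
  proof (rule ccontr)
    assume "\<not> P dvd c"
    then have "coprime c (P * q)"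
      unfolding Pq[symmetric] using prime_imp_coprime[OF P_prime] by (metis coprime_commute coprime_power_right_iff)
    then obtain u v where uv: "u * c + v * (P * q) = 1"
      using bezout_int[of c "P * q"] by (metis coprime_imp_gcd_eq_1)
    have "e c 0 [^] u = e (c * u) 0" by (simp add: e_def int_pow_pow)
    also have "\<dots> = e 1 0"
    proof (rule e_eqI)
      have "c * u - 1 = P * q * (-v)" using uv by (simp add: algebra_simps)
      then show "P * q dvd c * u - 1" by simp
    qed simp
    finally have xT: "x \<in> T" using subgroup_int_pow_closed[OF T(1) c, of u] by (simp add: e_10)
    have "x [^] (-i) \<otimes> e i 1 \<in> T"
      using subgroup.m_closed[OF T(1) subgroup_int_pow_closed[OF T(1) xT] w] .
    then have "y \<in> T" by (simp add: e_def int_pow_neg flip: m_assoc)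
    then have "carrier G \<subseteq> T" using generate_subgroup_incl[of "{x, y}" T] generated xT T(1) by simp
    then show False using T subgroup.subset by blast
  qed
  have central: "e c 0 \<otimes> a = a \<otimes> e c 0" if "P dvd c" "a \<in> carrier G" for c a
  proof -
    obtain k l where "a = e k l" using e_surj \<open>a \<in> carrier G\<close> by blast
    then show ?thesis using \<open>P dvd c\<close> by (auto simp: e_mult intro!: e_eqI)
  qed
  obtain c b where s: "s = e c 0 \<otimes> e i 1 [^] (b::int)" "e c 0 \<in> T"
    using subgroup_decompose[OF T(1) w assms(3)] by metis
  obtain d b' where t: "t = e d 0 \<otimes> e i 1 [^] (b'::int)" "e d 0 \<in> T"
    using subgroup_decompose[OF T(1) w assms(4)] by metis
  let ?w = "e i 1"
  have "s \<otimes> t = e c 0 \<otimes> (?w [^] b \<otimes> e d 0) \<otimes> ?w [^] b'" by (simp add: s t m_assoc)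
  also have "\<dots> = (e c 0 \<otimes> e d 0) \<otimes> (?w [^] b \<otimes> ?w [^] b')"
    by (simp add: central[OF P_dvd[OF t(2)], of "?w [^] b", symmetric] m_assoc)
  also have "\<dots> = (e d 0 \<otimes> e c 0) \<otimes> (?w [^] b' \<otimes> ?w [^] b)"
    by (simp add: e_mult add.commute flip: int_pow_mult)
  also have "\<dots> = e d 0 \<otimes> (?w [^] b' \<otimes> e c 0) \<otimes> ?w [^] b"
    by (simp add: central[OF P_dvd[OF s(2)], of "?w [^] b'", symmetric] m_assoc)
  also have "\<dots> = t \<otimes> s" by (simp add: s t m_assoc)
  finally show ?thesis .
qed

lemma nonnormal_iff: "A \<in> nonnormal_subgroups G \<longleftrightarrow> subgroup A G \<and> e q 0 \<notin> A \<and> A \<noteq> {\<one>}"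
  using normal_if_z_mem z_mem_if_normal one_is_normal by (auto simp: nonnormal_subgroups_def)

lemma z_ne_1: "e q 0 \<noteq> \<one>"
  using e_eq[of q 0 0 0] q_pos P_gt_1 by (auto simp: e_0 dest: zdvd_imp_le)

text \<open>A non-normal subgroup avoids \<open>x^q\<close>, so it meets \<open><x>\<close>
  trivially and is generated by a single \<open>x^i y\<close>. Conversely, a power of
  \<open>x^i y\<close> that lies in \<open><x>\<close> has exponent divisible by \<open>p\<close>
  and is trivial.\<close>

lemma nonnormal_subgroups_eq:
  "nonnormal_subgroups G = (\<lambda>i. generate G {e i 1}) ` {i \<in> {0..<P * q}. e i 1 [^] P = \<one>}"
proof
  show "nonnormal_subgroups G \<subseteq> (\<lambda>i. generate G {e i 1}) ` {i \<in> {0..<P * q}. e i 1 [^] P = \<one>}"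
  proof
    fix A assume "A \<in> nonnormal_subgroups G"
    then have A: "subgroup A G" "e q 0 \<notin> A" "A \<noteq> {\<one>}" by (auto simp: nonnormal_iff)
    have triv: "e c 0 = \<one>" if "e c 0 \<in> A" for c using z_mem_of_x_pow[OF A(1) that] A(2) by blast
    obtain a where a: "a \<in> A" "a \<noteq> \<one>" using A subgroup.one_closed[OF A(1)] by blast
    obtain i j where ij: "a = e i j" using e_surj subgroup.mem_carrier[OF A(1) a(1)] by blast
    have "\<not> P dvd j"
    proof
      assume "P dvd j"
      then have "a = e i 0" unfolding ij by (intro e_eqI) auto
      then show False using triv[of i] a by simp
    qed
    then obtain c where c: "e c 1 \<in> A" using snd_coprime_pow[OF A(1)] a(1) ij by blast
    have "e c 1 = e (c mod (P * q)) 1" by (rule e_eqI) (auto simp: mod_eq_dvd_iff[symmetric])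
    then obtain c where c: "e c 1 \<in> A" "c \<in> {0..<P * q}"
      using c P_gt_1 q_pos by (metis atLeastLessThan_iff pos_mod_bound pos_mod_sign mult_pos_pos zero_less_one less_trans)
    \<comment> \<open>The \<open>p\<close>-th power falls into \<open><x>\<close>, where
      \<open>A\<close> has only the identity.\<close>
    obtain d where "e c 1 [^] P = e d (P * 1)" using e_int_pow_snd by blast
    also have "\<dots> = e d 0" by (rule e_eqI) auto
    finally have "e c 1 [^] P = \<one>" using triv[of d] subgroup_int_pow_closed[OF A(1) c(1), of P] by simp
    moreover have "A = generate G {e c 1}"
    proof
      show "generate G {e c 1} \<subseteq> A" by (rule generate_singleton_subset[OF A(1) c(1)])
      show "A \<subseteq> generate G {e c 1}"
      proof
        fix t assume "t \<in> A"
        then obtain d b where "t = e d 0 \<otimes> e c 1 [^] (b::int)" "e d 0 \<in> A"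
          using subgroup_decompose[OF A(1) c(1)] by blast
        then have "t = e c 1 [^] b" using triv by simp
        then show "t \<in> generate G {e c 1}" using generate_singleton_mem_iff by auto
      qed
    qed
    ultimately show "A \<in> (\<lambda>i. generate G {e i 1}) ` {i \<in> {0..<P * q}. e i 1 [^] P = \<one>}" using c by blast
  qed
  show "(\<lambda>i. generate G {e i 1}) ` {i \<in> {0..<P * q}. e i 1 [^] P = \<one>} \<subseteq> nonnormal_subgroups G"
  proof clarify
    fix i assume i: "e i 1 [^] P = \<one>"
    have "e q 0 \<notin> generate G {e i 1}"
    proof
      assume "e q 0 \<in> generate G {e i 1}"
      then obtain s :: int where s: "e q 0 = e i 1 [^] s" using generate_singleton_mem_iff by auto
      obtain c where "e i 1 [^] s = e c (s * 1)" using e_int_pow_snd by blast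
      then have "P dvd s" using s by (simp add: e_eq)
      then have "e i 1 [^] s = \<one>" using i by (auto elim!: dvdE simp flip: int_pow_pow)
      then show False using s z_ne_1 by simp
    qed
    moreover have "e i 1 \<noteq> \<one>" using e_eq[of i 1 0 0] P_gt_1 by (auto simp: e_0 dest: zdvd_imp_le)
    then have "generate G {e i 1} \<noteq> {\<one>}" using generate.incl[of "e i 1" "{e i 1}" G] by auto
    moreover have "subgroup (generate G {e i 1}) G" by (rule generate_is_subgroup) simp
    ultimately show "generate G {e i 1} \<in> nonnormal_subgroups G" by (simp add: nonnormal_iff)
  qed
qed

text \<open>Distinct \<open>i\<close> give distinct subgroups: if \<open>x^i y\<close> is a power of
  \<open>x^j y\<close>, comparing exponents of \<open>y\<close> shows that the power is 1 modulo
  \<open>p\<close>.\<close>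

lemma card_nonnormal_subgroups:
  "card (nonnormal_subgroups G) = card {i \<in> {0..<P * q}. e i 1 [^] P = \<one>}"
  unfolding nonnormal_subgroups_eq
proof (rule card_image, rule inj_onI)
  fix i j assume i: "i \<in> {i \<in> {0..<P * q}. e i 1 [^] P = \<one>}" and j: "j \<in> {i \<in> {0..<P * q}. e i 1 [^] P = \<one>}"
    and eq: "generate G {e i 1} = generate G {e j 1}"
  have "e i 1 \<in> generate G {e j 1}" using eq generate.incl[of "e i 1" "{e i 1}" G] by simp
  then obtain s :: int where s: "e i 1 = e j 1 [^] s" using generate_singleton_mem_iff by auto
  obtain c where "e j 1 [^] s = e c (s * 1)" using e_int_pow_snd by blast
  then have "P dvd 1 - s" using s by (simp add: e_eq)
  moreover have "int (ord (e j 1)) dvd P" using j int_pow_eq_id[of "e j 1" P] by simp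
  ultimately have "e j 1 [^] s = e j 1 [^] (1::int)" unfolding int_pow_eq[OF e_closed] by (rule dvd_trans[rotated])
  then have "e i 1 = e j 1" using s by simp
  then have "P * q dvd i - j" by (simp add: e_eq)
  then show "i = j" using i j by (simp flip: mod_eq_dvd_iff)
qed

text \<open>Conjugation changes \<open>x^i y\<close> only by a power of \<open>x^q\<close>, an
  element of order \<open>p\<close>. This complements the lower bound \<open>p\<close> that holds in
  every \<open>p\<close>-group.\<close>

lemma card_conj_class_le:
  assumes "A \<in> nonnormal_subgroups G"
  shows "card (conj_class G A) \<le> p"
proof -
  obtain i where A: "A = generate G {e i 1}" using assms by (auto simp: nonnormal_subgroups_eq)
  have "conj_class G A \<subseteq> (\<lambda>c. generate G {e (i + q * c) 1}) ` {0..<P}"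
  proof
    fix B assume "B \<in> conj_class G A"
    then obtain g where g: "g \<in> carrier G" "B = g <# A #> inv g" by (auto simp: orbit_def)
    then obtain k l where kl: "g = e k l" using e_surj by blast
    have "A \<subseteq> carrier G" using A generate_incl by simp
    have "B = {g \<otimes> a \<otimes> inv g | a. a \<in> A}"
      using mem_conj[OF \<open>A \<subseteq> carrier G\<close> g(1)] g(2) by blast
    also have "\<dots> = {(g \<otimes> e i 1 \<otimes> inv g) [^] s | s :: int. True}"
      unfolding A generate_pow[OF e_closed] conj_int_pow[OF g(1) e_closed, symmetric] by blast
    also have "\<dots> = generate G {g \<otimes> e i 1 \<otimes> inv g}"
      using g(1) by (subst generate_pow) auto
    also have "g \<otimes> e i 1 \<otimes> inv g = e (i + q * ((l * i - k) mod P)) 1"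
      unfolding kl conj_e
      by (rule e_eqI) (auto simp flip: right_diff_distrib simp: minus_mod_eq_mult_div mult_ac)
    finally show "B \<in> (\<lambda>c. generate G {e (i + q * c) 1}) ` {0..<P}" using P_gt_1 by auto
  qed
  then have "card (conj_class G A) \<le> card {0..<P}" by (intro surj_card_le) auto
  then show ?thesis by (simp add: P_def)
qed

lemma minimal: "minimal_non_dedekind G"
proof (intro minimal_non_dedekind.intro minimal_non_dedekind_axioms.intro is_group)
  show "finite (carrier G)" by (rule finite_carrier)
  have "e 0 1 [^] P = \<one>" using y_pow by (simp add: e_01 P_def int_pow_int)
  then show "nonnormal_subgroups G \<noteq> {}"
    using P_gt_1 q_pos unfolding nonnormal_subgroups_eq by (auto intro!: exI[of _ 0])
  show "t \<otimes> a \<otimes> inv t \<in> A"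
    if "subgroup T G" "T \<noteq> carrier G" "subgroup A G" "A \<subseteq> T" "t \<in> T" "a \<in> A" for T A t a
  proof -
    have "t \<in> carrier G" "a \<in> carrier G" using that subgroup.mem_carrier by metis+
    moreover have "t \<otimes> a = a \<otimes> t" using commutative_proper[OF that(1,2,5)] that(4,6) by blast
    ultimately have "t \<otimes> a \<otimes> inv t = a" by (simp add: m_assoc)
    then show ?thesis using that(6) by simp
  qed
  show "A \<lhd> G" if "N \<lhd> G" "N \<noteq> {\<one>}" "subgroup A G" "N \<subseteq> A" for N A
    using normal_if_z_mem[OF that(3)] z_mem_if_normal[OF that(1,2)] that(4) by blast
qed

end

section \<open>Counting the non-normal subgroups of the modular group\<close>

lemma (in modular_p_group) e_pow_p: "e i 1 [^] P = \<one> \<longleftrightarrow> P * q dvd P * i + q * i * int (p * (p - 1) div 2)"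
proof -
  have "e i 1 [^] P = e (P * i + q * i * int (p * (p - 1) div 2)) P"
    by (simp add: P_def int_pow_int e_pow)
  then show ?thesis using e_eq[of _ P 0 0] by (simp add: e_0)
qed

text \<open>The condition on \<open>i\<close> becomes \<open>q dvd i\<close>. For odd
  \<open>p\<close> the factor \<open>p (p - 1) / 2\<close> is divisible by \<open>p\<close>. For
  \<open>p = 2\<close> the left side is \<open>2 (1 + q/2) i\<close>, and \<open>1 + q/2\<close> is
  odd because \<open>n \<ge> 4\<close>.\<close>

lemma (in modular_p_group) card_nonnormal_subgroups_modular:
  assumes "p = 2 \<longrightarrow> n \<ge> 4"
  shows "card (nonnormal_subgroups G) = p"
proof -
  define h where "h = int (p * (p - 1) div 2)"
  have iff: "P * q dvd P * i + q * i * h \<longleftrightarrow> q dvd i" for i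
  proof (cases "p = 2")
    case True
    have P2: "P = 2" unfolding P_def using True by simp
    have h1: "h = 1" using True by (simp add: h_def)
    have "4 \<le> n" using assms True by simp
    then have "n - 2 = Suc (Suc (n - 4))" by simp
    then have r: "q = 2 * (2 * 2 ^ (n - 4))" unfolding q_def P2 by simp
    let ?r = "2 ^ (n - 4) :: int"
    have cop: "coprime q (1 + 2 * ?r)" unfolding q_def P2 by simp
    have "P * i + q * i * h = 2 * ((1 + 2 * ?r) * i)"
      unfolding h1 P2 r by (simp add: algebra_simps)
    then have "P * q dvd P * i + q * i * h \<longleftrightarrow> q dvd (1 + 2 * ?r) * i"
      unfolding P2 by simp
    then show ?thesis using cop coprime_dvd_mult_right_iff by blast
  next
    case False
    then have "odd p" using prime_p primes_dvd_imp_eq two_is_prime_nat by blast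
    then have "p dvd p * (p - 1) div 2" by (metis dvd_div_mult_self dvd_triv_left div_mult_swap odd_even_add even_diff_nat odd_one)
    then have "P dvd h" unfolding P_def h_def by (simp only: of_nat_dvd_iff)
    then obtain t where t: "h = P * t" by (auto elim: dvdE)
    have eq: "P * i + q * i * h = P * i + P * q * (i * t)" unfolding t by (simp add: algebra_simps)
    show ?thesis unfolding eq using P_gt_1 by (simp add: dvd_add_left_iff)
  qed
  have e_iff: "e i 1 [^] P = \<one> \<longleftrightarrow> q dvd i" for i
    unfolding e_pow_p h_def[symmetric] by (rule iff)
  have "{i \<in> {0..<P * q}. e i 1 [^] P = \<one>} = (\<lambda>t. q * t) ` {0..<P}"
  proof
    show "{i \<in> {0..<P * q}. e i 1 [^] P = \<one>} \<subseteq> (\<lambda>t. q * t) ` {0..<P}"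
    proof
      fix i assume i: "i \<in> {i \<in> {0..<P * q}. e i 1 [^] P = \<one>}"
      then obtain t where "i = q * t" by (auto simp: e_iff dvd_def)
      then show "i \<in> (\<lambda>t. q * t) ` {0..<P}" using i q_pos by (auto simp: zero_le_mult_iff mult.commute[of P])
    qed
    show "(\<lambda>t. q * t) ` {0..<P} \<subseteq> {i \<in> {0..<P * q}. e i 1 [^] P = \<one>}"
      using q_pos by (auto simp: e_iff mult.commute[of P])
  qed
  then have "card (nonnormal_subgroups G) = card ((\<lambda>t. q * t) ` {0..<P})"
    by (simp only: card_nonnormal_subgroups)
  also have "\<dots> = p" using q_pos by (subst card_image) (auto simp: inj_on_def P_def)
  finally show ?thesis .
qed

text \<open>With \<open>q = 2\<close> the factor \<open>1 + q/2\<close> is even: the exponent is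
  \<open>4 i\<close>, so all four \<open>x^i y\<close> are involutions.\<close>

lemma (in modular_p_group) card_nonnormal_subgroups_order_8:
  assumes "p = 2" "n = 3"
  shows "card (nonnormal_subgroups G) = 4"
proof -
  have P2: "P = 2" unfolding P_def using assms by simp
  have q2: "q = 2" unfolding q_def P2 using assms by simp
  have "int (p * (p - 1) div 2) = 1" using assms by simp
  then have "e i 1 [^] P = \<one>" for i unfolding e_pow_p by (simp only: P2 q2) simp
  then have "{i \<in> {0..<P * q}. e i 1 [^] P = \<one>} = {0..<P * q}" by auto
  also have "\<dots> = {0..<4}" unfolding P2 q2 by simp
  finally have "{i \<in> {0..<P * q}. e i 1 [^] P = \<one>} = {0..<4}" .
  then show ?thesis by (simp add: card_nonnormal_subgroups)
qed

text \<open>Classes have at most \<open>p\<close> members here and at least \<open>p\<close> in any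
  \<open>p\<close>-group, so \<open>p c\<close> subgroups form exactly \<open>c\<close>
  classes.\<close>

lemma (in modular_p_group) d_prime_modular:
  assumes "card (nonnormal_subgroups G) = p * c"
  shows "d_prime G = ((real n - 2) * (real p + 1) + 3 + c) / ((real n - 2) * (real p + 1) + 3 + p * c)"
proof -
  interpret minimal_non_dedekind G by (rule minimal)
  \<comment> \<open>The count of normal subgroups is inherited from the general theory; the elements
    obtained need not be related to \<open>x\<close> and \<open>y\<close>.\<close>
  obtain k g z where "minimal_non_dedekind_p_group G p n k g z"
    using ex_p_group_structure[OF prime_p order_eq] by blast
  then interpret K: minimal_non_dedekind_p_group G p n k g z .
  have fin: "finite (nonnormal_subgroups G)"
    using finite_subgroups[OF finite_carrier] by (rule finite_subset[rotated]) (auto simp: subgroups_def nonnormal_subgroups_def)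
  have "card (nonnormal_subgroups G) = card (\<Union> (conj_class G ` nonnormal_subgroups G))"
    by (simp add: nonnormal_Union)
  also have "\<dots> \<le> (\<Sum>C\<in>conj_class G ` nonnormal_subgroups G. card C)"
    by (rule card_Union_le_sum_card)
  also have "\<dots> \<le> card (conj_class G ` nonnormal_subgroups G) * p"
    using sum_bounded_above[of "conj_class G ` nonnormal_subgroups G" card p] card_conj_class_le by auto
  finally have "c \<le> card (conj_class G ` nonnormal_subgroups G)"
    using assms K.p_gt_1 by (simp add: mult.commute)
  moreover have "card (conj_class G ` nonnormal_subgroups G) \<le> c"
    using K.nonnormal_classes(2) assms K.p_gt_1 by simp
  ultimately have "card (conj_class G ` nonnormal_subgroups G) = c" by simp
  then show ?thesis using assms by (simp add: K.d_prime_eq)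
qed

subsection \<open>The presentations\<close>

text \<open>The action on normal forms \<open>(i, j)\<close> for \<open>x^i y^j\<close> by left multiplication. It lives on pairs of
  integers, so the relations hold only modulo \<open>p^(n - 1)\<close> and \<open>p\<close>; for \<open>q = p^(n - 2)\<close> the factor
  \<open>1 - q\<close> inverts \<open>1 + q\<close> there.\<close>

fun word_step :: "int \<Rightarrow> xy \<times> bool \<Rightarrow> int \<times> int \<Rightarrow> int \<times> int" where
  "word_step q (Gen_x, True) (i, j) = (i + 1, j)"
| "word_step q (Gen_x, False) (i, j) = (i - 1, j)"
| "word_step q (Gen_y, True) (i, j) = (i * (1 + q), j + 1)"
| "word_step q (Gen_y, False) (i, j) = (i * (1 - q), j - 1)"

definition word_act :: "int \<Rightarrow> xy word \<Rightarrow> int \<times> int \<Rightarrow> int \<times> int" where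
  "word_act q w = foldr (word_step q) w"

definition pair_cong :: "int \<Rightarrow> int \<Rightarrow> int \<times> int \<Rightarrow> int \<times> int \<Rightarrow> bool" where
  "pair_cong D P s t \<longleftrightarrow> D dvd fst s - fst t \<and> P dvd snd s - snd t"

lemma word_act_Nil [simp]: "word_act q [] s = s"
  and word_act_append [simp]: "word_act q (u @ v) s = word_act q u (word_act q v s)"
  and word_act_Cons [simp]: "word_act q (a # v) s = word_step q a (word_act q v s)"
  by (simp_all add: word_act_def)

lemma word_pow_Suc [simp]: "word_pow w (Suc k) = w @ word_pow w k"
  and word_pow_0 [simp]: "word_pow w 0 = []"
  by (simp_all add: word_pow_def)

lemma word_pow_Suc2: "word_pow w (Suc k) = word_pow w k @ w"
  by (induction k) auto

lemma word_act_pow_x: "word_act q (word_pow x_gen k) (i, j) = (i + int k, j)"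
  by (induction k) auto

lemma word_act_pow_y: "word_act q (word_pow y_gen k) (i, j) = (i * (1 + q) ^ k, j + int k)"
  by (induction k) (auto simp: mult_ac)

lemma pair_cong_refl: "pair_cong D P s s"
  by (simp add: pair_cong_def)

lemma pair_cong_sym: "pair_cong D P s t \<Longrightarrow> pair_cong D P t s"
  by (simp add: pair_cong_def dvd_diff_commute)

lemma pair_cong_trans: "\<lbrakk>pair_cong D P s t; pair_cong D P t u\<rbrakk> \<Longrightarrow> pair_cong D P s u"
  unfolding pair_cong_def by (metis diff_add_cancel dvd_add add_diff_eq)

lemma word_step_pair_cong:
  assumes "pair_cong D P s t"
  shows "pair_cong D P (word_step q a s) (word_step q a t)"
proof -
  obtain b f where a: "a = (b, f)" by fastforce
  obtain i j k l where "s = (i, j)" "t = (k, l)" by fastforce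
  then show ?thesis using assms a
    by (cases b; cases f) (auto simp: pair_cong_def simp flip: left_diff_distrib)
qed

lemma word_act_pair_cong: "pair_cong D P s t \<Longrightarrow> pair_cong D P (word_act q w s) (word_act q w t)"
  by (induction w) (auto intro: word_step_pair_cong)

text \<open>The binomial expansion stops after the linear term, since \<open>q^2\<close> vanishes
  modulo \<open>D\<close>.\<close>

lemma one_plus_power_cong:
  fixes q :: int
  assumes "D dvd q * q"
  shows "D dvd (1 + q) ^ k - (1 + int k * q)"
proof (induction k)
  case (Suc k)
  have "(1 + q) ^ Suc k - (1 + int (Suc k) * q) = (1 + q) * ((1 + q) ^ k - (1 + int k * q)) + int k * (q * q)"
    by (simp add: algebra_simps)
  then show ?case using Suc.IH assms by simp
qed simp

definition M_rels :: "nat \<Rightarrow> nat \<Rightarrow> (xy word \<times> xy word) set" where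
  "M_rels p n = {(word_pow x_gen (p ^ (n - 1)), []), (word_pow y_gen p, []),
      (y_gen @ x_gen, word_pow x_gen (p ^ (n - 2) + 1) @ y_gen)}"

text \<open>Soundness of the model: words equal in the group act equally on normal forms up to
  \<open>pair_cong\<close>. This bounds the presented group from below.\<close>

lemma pres_cong_word_act:
  assumes n3: "n \<ge> 3" and uv: "(u, v) \<in> pres_cong (M_rels p n)"
  shows "pair_cong (int p ^ (n - 1)) (int p) (word_act (int p ^ (n - 2)) u s) (word_act (int p ^ (n - 2)) v s)"
proof -
  define q where "q = int p ^ (n - 2)"
  have D: "int p ^ (n - 1) = int p * q"
  proof -
    have "n - 1 = Suc (n - 2)" using n3 by simp
    then show ?thesis by (simp add: q_def)
  qed
  have "int p dvd q" using n3 by (simp add: q_def)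
  then have Dqq: "int p * q dvd q * q" by simp
  have "pair_cong (int p * q) (int p) (word_act q u s) (word_act q v s)"
    using uv
  proof (induction arbitrary: s rule: pres_cong.induct)
    case (rel u v)
    obtain i j where s: "s = (i, j)" by fastforce
    \<comment> \<open>The relation \<open>y^p = 1\<close>: modulo \<open>p q\<close> the factor
      \<open>(1 + q)^p\<close> is \<open>1 + p q\<close>, hence 1.\<close>
    have "int p * q dvd i * (1 + q) ^ p - i"
    proof -
      have "int p * q dvd i * ((1 + q) ^ p - (1 + int p * q)) + int p * q * i"
        using one_plus_power_cong[OF Dqq, of p] by simp
      also have "\<dots> = i * (1 + q) ^ p - i" by (simp add: algebra_simps)
      finally show ?thesis .
    qed
    moreover have "int (p ^ (n - 1)) = int p * q" using D by simp
    moreover have "int (p ^ (n - 2) + 1) = q + 1" by (simp add: q_def)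
    ultimately show ?case using rel unfolding s
      by (auto simp: M_rels_def word_act_pow_x word_act_pow_y pair_cong_def algebra_simps simp del: word_pow_Suc)
  next
    case (cancel a f)
    obtain i j where s: "s = (i, j)" by fastforce
    \<comment> \<open>Cancellation of \<open>y\<close> against its inverse multiplies the first
      coordinate by \<open>(1 + q)(1 - q) = 1 - q^2\<close>.\<close>
    have "int p * q dvd - (q * q) * i" using Dqq by simp
    then show ?case unfolding s
      by (cases a; cases f) (auto simp: pair_cong_def algebra_simps)
  next
    case (append u u' v v')
    have "pair_cong (int p * q) (int p) (word_act q u (word_act q v s)) (word_act q u (word_act q v' s))"
      by (rule word_act_pair_cong) (rule append.IH)
    also note append.IH(1)[of "word_act q v' s"]
    finally (pair_cong_trans) show ?case by simp
  next
    case (trans u v w)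
    show ?case by (rule pair_cong_trans[OF trans.IH])
  qed (auto intro: pair_cong_refl pair_cong_sym)
  then show ?thesis unfolding D q_def .
qed

lemma presented_pow:
  "pres_cong R `` {u} [^]\<^bsub>presented_group R\<^esub> (k::nat) = pres_cong R `` {word_pow u k}"
proof (induction k)
  case 0
  then show ?case by (simp add: presented_group_one)
next
  case (Suc k)
  then show ?case unfolding word_pow_Suc2 by (simp add: presented_group_mult)
qed

lemma presented_generated:
  fixes R :: "('g word \<times> 'g word) set"
  shows "generate (presented_group R) (range (\<lambda>a. pres_cong R `` {[(a, True)]})) = carrier (presented_group R)"
    (is "generate ?M ?S = _")
proof
  interpret group ?M by (rule presented_group_is_group)
  have S: "?S \<subseteq> carrier ?M" by (auto simp: presented_group_carrier)
  show "generate ?M ?S \<subseteq> carrier ?M" using generate_incl[OF S] .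
  interpret H: subgroup "generate ?M ?S" ?M by (rule generate_is_subgroup[OF S])
  have letter: "pres_cong R `` {[(a, f)]} \<in> generate ?M ?S" for a f
  proof (cases f)
    case True
    then show ?thesis by (auto intro: generate.incl)
  next
    case False
    have "pres_cong R `` {[(a, False)]} \<otimes>\<^bsub>?M\<^esub> pres_cong R `` {[(a, True)]} = \<one>\<^bsub>?M\<^esub>"
      using pres_cong.cancel[of a False R] by (simp add: presented_group_mult presented_group_one pres_cong_class_eq)
    then have "inv\<^bsub>?M\<^esub> (pres_cong R `` {[(a, True)]}) = pres_cong R `` {[(a, False)]}"
      by (intro inv_equality) (auto simp: presented_group_carrier)
    moreover have "inv\<^bsub>?M\<^esub> (pres_cong R `` {[(a, True)]}) \<in> generate ?M ?S" by (rule generate.inv) simp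
    ultimately show ?thesis using False by simp
  qed
  have "pres_cong R `` {u} \<in> generate ?M ?S" for u
  proof (induction u)
    case Nil
    then show ?case using H.one_closed by (simp add: presented_group_one)
  next
    case (Cons a u)
    then show ?case using H.m_closed[OF letter[of "fst a" "snd a"] Cons.IH] by (simp add: presented_group_mult)
  qed
  then show "carrier ?M \<subseteq> generate ?M ?S" by (auto simp: presented_group_carrier)
qed

lemma modular_p_group_M_group:
  assumes p: "prime p" and n3: "n \<ge> 3"
  shows "modular_p_group (M_group p n) p n
    (pres_cong (M_rels p n) `` {x_gen}) (pres_cong (M_rels p n) `` {y_gen})"
proof -
  let ?R = "M_rels p n"
  let ?M = "presented_group ?R"
  let ?X = "pres_cong ?R `` {x_gen}" and ?Y = "pres_cong ?R `` {y_gen}"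
  interpret M: group ?M by (rule presented_group_is_group)
  have X: "?X \<in> carrier ?M" and Y: "?Y \<in> carrier ?M" by (auto simp: presented_group_carrier)
  have Xp: "?X [^]\<^bsub>?M\<^esub> (p ^ (n - 1)) = \<one>\<^bsub>?M\<^esub>" and Yp: "?Y [^]\<^bsub>?M\<^esub> p = \<one>\<^bsub>?M\<^esub>"
    by (auto simp: presented_pow presented_group_one pres_cong_class_eq M_rels_def intro: pres_cong.rel)
  have rel: "?Y \<otimes>\<^bsub>?M\<^esub> ?X = ?X [^]\<^bsub>?M\<^esub> (p ^ (n - 2) + 1) \<otimes>\<^bsub>?M\<^esub> ?Y"
    unfolding presented_pow presented_group_mult pres_cong_class_eq
    by (rule pres_cong.rel) (simp add: M_rels_def)
  have "range (\<lambda>a. pres_cong ?R `` {[(a, True)]}) = {?X, ?Y}"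
    by (auto simp: image_iff) (metis xy.exhaust)+
  then have gen: "generate ?M {?X, ?Y} = carrier ?M" using presented_generated[of ?R] by simp
  have indep: "int p ^ (n - 1) dvd i \<and> int p dvd j"
    if ij: "?X [^]\<^bsub>?M\<^esub> (i::int) \<otimes>\<^bsub>?M\<^esub> ?Y [^]\<^bsub>?M\<^esub> (j::int) = \<one>\<^bsub>?M\<^esub>" for i j
  proof -
    let ?D = "int p ^ (n - 1)"
    have p0: "int p > 0" using p by (simp add: prime_gt_0_nat)
    \<comment> \<open>Words have only natural powers, so the integer exponents are replaced by their
      nonnegative residues.\<close>
    define i' j' where "i' = nat (i mod ?D)" and "j' = nat (j mod int p)"
    have i': "int i' = i mod ?D" and j': "int j' = j mod int p" using p0 by (auto simp: i'_def j'_def)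
    have "int (M.ord ?X) dvd ?D" using Xp M.pow_eq_id[OF X] by (metis of_nat_dvd_iff of_nat_power)
    then have "?X [^]\<^bsub>?M\<^esub> i = ?X [^]\<^bsub>?M\<^esub> i'"
      using M.int_pow_eq[OF X, of i "int i'"] i' by (metis dvd_diff_commute dvd_minus_mod dvd_trans int_pow_int)
    moreover have "int (M.ord ?Y) dvd int p" using Yp M.pow_eq_id[OF Y] by simp
    then have "?Y [^]\<^bsub>?M\<^esub> j = ?Y [^]\<^bsub>?M\<^esub> j'"
      using M.int_pow_eq[OF Y, of j "int j'"] j' by (metis dvd_diff_commute dvd_minus_mod dvd_trans int_pow_int)
    ultimately have "(word_pow x_gen i' @ word_pow y_gen j', []) \<in> pres_cong ?R"
      using ij by (simp add: presented_pow presented_group_mult presented_group_one pres_cong_class_eq)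
    \<comment> \<open>Applied to the normal form \<open>(0, 0)\<close> of the identity, the word
      \<open>x^i' y^j'\<close> yields \<open>(i', j')\<close>, which must be congruent to
      \<open>(0, 0)\<close>.\<close>
    from pres_cong_word_act[OF n3 this, of "(0, 0)"] have "?D dvd int i'" "int p dvd int j'"
      by (auto simp: word_act_pow_x word_act_pow_y pair_cong_def)
    then show ?thesis unfolding i' j' by (simp add: dvd_mod_iff)
  qed
  have "modular_p_group ?M p n ?X ?Y"
    by (intro modular_p_group.intro modular_p_group_axioms.intro M.is_group p n3 X Y Xp Yp rel gen indep)
  then show ?thesis by (simp add: M_group_def M_rels_def)
qed

lemma pres_cong_subset:
  assumes "R \<subseteq> pres_cong R'"
  shows "pres_cong R \<subseteq> pres_cong R'"
proof -
  have "(u, v) \<in> pres_cong R'" if "(u, v) \<in> pres_cong R" for u v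
    using that
    by (induction rule: pres_cong.induct) (use assms in \<open>auto intro: pres_cong.intros\<close>)
  then show ?thesis by auto
qed

text \<open>As \<open>x^4 = 1\<close> makes \<open>x_inv\<close> and \<open>x^3\<close> congruent,
  both sets of relations generate the same congruence. The two groups are therefore equal, not
  merely isomorphic.\<close>

lemma D8_eq: "D8 = M_group 2 3"
proof -
  let ?R1 = "{(word_pow x_gen 4, []), (word_pow y_gen 2, []), (y_gen @ x_gen, x_inv @ y_gen)}"
  have x4: "word_pow x_gen 4 = x_gen @ word_pow x_gen 3"
    by (simp add: numeral_eq_Suc)
  have inv3: "(x_inv, word_pow x_gen 3) \<in> pres_cong R" if "(word_pow x_gen 4, []) \<in> R" for R
  proof -
    have "(x_inv @ word_pow x_gen 4, x_inv @ []) \<in> pres_cong R"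
      using that by (intro pres_cong.append pres_cong.refl pres_cong.rel)
    moreover have "([(Gen_x, False), (Gen_x, \<not> False)] @ word_pow x_gen 3, [] @ word_pow x_gen 3) \<in> pres_cong R"
      by (intro pres_cong.append pres_cong.refl pres_cong.cancel)
    ultimately show ?thesis
      by (simp add: x4) (meson pres_cong.sym pres_cong.trans)
  qed
  have rels: "M_rels 2 3 = {(word_pow x_gen 4, []), (word_pow y_gen 2, []), (y_gen @ x_gen, word_pow x_gen 3 @ y_gen)}"
    by (simp add: M_rels_def)
  have "(y_gen @ x_gen, word_pow x_gen 3 @ y_gen) \<in> pres_cong ?R1"
    by (rule pres_cong.trans[of _ "x_inv @ y_gen"]) (auto intro!: pres_cong.rel pres_cong.append[OF inv3 pres_cong.refl, of _ y_gen, simplified])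
  moreover have "(y_gen @ x_gen, x_inv @ y_gen) \<in> pres_cong (M_rels 2 3)"
    by (rule pres_cong.trans[of _ "word_pow x_gen 3 @ y_gen"])
       (auto simp: rels intro!: pres_cong.rel pres_cong.sym[OF pres_cong.append[OF inv3 pres_cong.refl, of _ y_gen, simplified]])
  ultimately have eq: "pres_cong ?R1 = pres_cong (M_rels 2 3)"
    by (intro equalityI pres_cong_subset) (auto simp: rels intro: pres_cong.rel)
  have "M_group 2 3 = presented_group (M_rels 2 3)" by (simp only: M_group_def M_rels_def)
  then show ?thesis by (simp only: D8_def presented_group_def eq)
qed

lemma M_group_values:
  assumes p: "prime p" and n3: "n \<ge> 3"
  shows "d_star (M_group p n) = d_prime (M_group p n)"
    and "p = 2 \<longrightarrow> n \<ge> 4 \<Longrightarrow>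
      d_prime (M_group p n) = ((real n - 2) * (real p + 1) + 4) / ((real n - 1) * (real p + 1) + 2)"
    and "p = 2 \<Longrightarrow> n = 3 \<Longrightarrow> d_prime (M_group p n) = 4 / 5"
proof -
  interpret M: modular_p_group "M_group p n" p n "pres_cong (M_rels p n) `` {x_gen}" "pres_cong (M_rels p n) `` {y_gen}"
    by (rule modular_p_group_M_group[OF assms])
  show "d_star (M_group p n) = d_prime (M_group p n)"
    by (rule minimal_non_dedekind.d_star_eq[OF M.minimal])
  \<comment> \<open>Here \<open>p\<close> non-normal subgroups form one class, \<open>c = 1\<close>;
    for order 8 the four form two classes, \<open>c = 2\<close>.\<close>
  show "d_prime (M_group p n) = ((real n - 2) * (real p + 1) + 4) / ((real n - 1) * (real p + 1) + 2)"
    if "p = 2 \<longrightarrow> n \<ge> 4"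
    using M.d_prime_modular[of 1] M.card_nonnormal_subgroups_modular[OF that] by (simp add: algebra_simps)
  show "d_prime (M_group p n) = 4 / 5" if "p = 2" "n = 3"
    using M.d_prime_modular[of 2] M.card_nonnormal_subgroups_order_8[OF that] that by simp
qed

theorem theoremD:
  fixes G :: "('a, 'b) monoid_scheme" and p n :: nat
  assumes "prime p" and "n \<ge> 3" and "group G" and "order G = p ^ n"
  shows
    "(p = 2 \<and> n = 3 \<longrightarrow>
        (d_star G > 4 / 5 \<longrightarrow> dedekind_group G) \<and>
        4 / 5 = d_star D8 \<and> d_star D8 = d_prime D8) \<and>
     ((p = 2 \<longrightarrow> n \<ge> 4) \<longrightarrow>
        (d_star G > ((real n - 2) * (real p + 1) + 4) / ((real n - 1) * (real p + 1) + 2) \<longrightarrow>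
           dedekind_group G) \<and>
        ((real n - 2) * (real p + 1) + 4) / ((real n - 1) * (real p + 1) + 2)
          = d_star (M_group p n) \<and>
        d_star (M_group p n) = d_prime (M_group p n))"
proof -
  interpret group G by fact
  have fin: "finite (carrier G)"
    using assms by (metis order_gt_0_iff_finite prime_gt_0_nat zero_less_power)
  \<comment> \<open>Both implications are proved by contraposition: a group that is not Dedekind has
    a minimal section whose \<open>d_prime\<close> bounds \<open>d_star G\<close> from
    above.\<close>
  have bounds: "d_star G \<le> ((real n - 2) * (real p + 1) + 4) / ((real n - 1) * (real p + 1) + 2) \<and>
      (p = 2 \<and> n = 3 \<longrightarrow> d_star G \<le> 4 / 5)" if nd: "\<not> dedekind_group G"
  proof -
    obtain H K where H: "subgroup H G" and K: "K \<lhd> G\<lparr>carrier := H\<rparr>"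
      and min: "minimal_non_dedekind (G\<lparr>carrier := H\<rparr> Mod K)" and dvd: "order (G\<lparr>carrier := H\<rparr> Mod K) dvd order G"
      using ex_minimal_section[OF fin nd] by metis
    obtain m where m: "m \<le> n" "order (G\<lparr>carrier := H\<rparr> Mod K) = p ^ m"
      using dvd divides_primepow_nat[OF assms(1)] by (auto simp: assms(4))
    obtain k g z where "minimal_non_dedekind_p_group (G\<lparr>carrier := H\<rparr> Mod K) p m k g z"
      using minimal_non_dedekind.ex_p_group_structure[OF min assms(1) m(2)] by blast
    then interpret S: minimal_non_dedekind_p_group "G\<lparr>carrier := H\<rparr> Mod K" p m k g z .
    show ?thesis
      using d_star_le[OF fin H K] S.d_prime_le[OF m(1)] S.d_prime_le_order_8 m(1) by auto
  qed
  have "4 / 5 = d_star D8 \<and> d_star D8 = d_prime D8"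
    using M_group_values(1,3)[of 2 3] by (simp add: D8_eq)
  then show ?thesis
    using bounds M_group_values(1,2)[OF assms(1,2)] by (intro conjI impI) (auto simp flip: not_le)
qed

end
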